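(* Let $T$ be a special tree and suppose $X\subseteq\mathcal R(T)$ (with the subspace topology) is scattered. Then $X$ is an end space.
   Context: A tree is a partially ordered set $(T,\le)$ with a minimum (its root) such that $\{s\in T:s\le t\}$ is well-ordered for every $t\in T$. It is special if it is a countable union of antichains (sets of pairwise incomparable elements). A ray of $T$ is a non-empty downward closed chain of $T$ with no maximal element; $\mathcal R(T)$ is the set of all rays with the subspace topology inherited from the power set $\mathcal P(T)\simeq2^T$ (product topology). A space is scattered if each of its non-empty subspaces has an isolated point. For a graph $G$, a ray of $G$ is a one-way infinite path; two rays are equivalent if no finite set of vertices separates them (i.e. for every finite set $F$ of vertices, they have tails in the same component of $G-F$). The equivalence classes are the ends of $G$, and $\Omega(G)$ is the set of ends with the topology having as basic open sets, for $\varepsilon\in\Omega(G)$ and $F$ a finite set of vertices, $\Omega(\varepsilon,F)=\{\eta\in\Omega(G):\text{no }R\in\varepsilon\text{ and }R'\in\eta\text{ are separated by }F\}$. A space is an end space if it is homeomorphic to $\Omega(G)$ for some graph $G$. *)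

theory Defs
  imports "HOL-Analysis.Analysis"
begin

section \<open>Order trees and their ray spaces\<close>

definition order_tree :: "'a set \<Rightarrow> 'a rel \<Rightarrow> bool" where
  "order_tree T r \<longleftrightarrow>
     partial_order_on T r \<and>
     (\<exists>m\<in>T. \<forall>t\<in>T. (m, t) \<in> r) \<and>
     (\<forall>t\<in>T. well_order_on (under r t) (Restr r (under r t)))"

definition antichain_in :: "'a set \<Rightarrow> 'a rel \<Rightarrow> 'a set \<Rightarrow> bool" where
  "antichain_in T r A \<longleftrightarrow>
     A \<subseteq> T \<and> (\<forall>s\<in>A. \<forall>t\<in>A. s \<noteq> t \<longrightarrow> (s, t) \<notin> r \<and> (t, s) \<notin> r)"

definition special :: "'a set \<Rightarrow> 'a rel \<Rightarrow> bool" where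
  "special T r \<longleftrightarrow>
     (\<exists>A :: nat \<Rightarrow> 'a set. (\<forall>n. antichain_in T r (A n)) \<and> T = (\<Union>n. A n))"

definition tree_rays :: "'a set \<Rightarrow> 'a rel \<Rightarrow> 'a set set" where
  "tree_rays T r =
     {R. R \<subseteq> T \<and> R \<noteq> {} \<and> R \<in> Chains r \<and>
         (\<forall>t\<in>R. \<forall>s\<in>T. (s, t) \<in> r \<longrightarrow> s \<in> R) \<and>
         \<not> (\<exists>t\<in>R. \<forall>s\<in>R. (t, s) \<in> r \<longrightarrow> s = t)}"

text \<open>The topology that \<^term>\<open>Pow T\<close> receives from the product of discrete two-point spaces,
  by identifying a subset of \<^term>\<open>T\<close> with its characteristic function. Since
  \<^const>\<open>product_topology\<close> lives on extensional functions, the characteristic function is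
  restricted to \<^term>\<open>T\<close>.\<close>

definition powerset_topology :: "'a set \<Rightarrow> 'a set topology" where
  "powerset_topology T =
     pullback_topology (Pow T) (\<lambda>A. restrict (\<lambda>t. t \<in> A) T)
       (product_topology (\<lambda>_. discrete_topology (UNIV :: bool set)) T)"

definition ray_space :: "'a set \<Rightarrow> 'a rel \<Rightarrow> 'a set topology" where
  "ray_space T r = subtopology (powerset_topology T) (tree_rays T r)"

definition scattered_space :: "'b topology \<Rightarrow> bool" where
  "scattered_space X \<longleftrightarrow>
     (\<forall>S. S \<subseteq> topspace X \<and> S \<noteq> {} \<longrightarrow> (\<exists>x\<in>S. openin (subtopology X S) {x}))"


section \<open>Graphs and their end spaces\<close>

definition simple_graph :: "'v set \<Rightarrow> 'v set set \<Rightarrow> bool" where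
  "simple_graph V E \<longleftrightarrow> E \<subseteq> {e. e \<subseteq> V \<and> card e = 2}"

definition adj_off :: "'v set \<Rightarrow> 'v set set \<Rightarrow> 'v set \<Rightarrow> 'v rel" where
  "adj_off V E F = {(u, v). u \<in> V - F \<and> v \<in> V - F \<and> {u, v} \<in> E}"

text \<open>The vertex sets of the components of the graph minus \<^term>\<open>F\<close>.\<close>

definition components_off :: "'v set \<Rightarrow> 'v set set \<Rightarrow> 'v set \<Rightarrow> 'v set set" where
  "components_off V E F = {{v. (u, v) \<in> (adj_off V E F)\<^sup>*} | u. u \<in> V - F}"

text \<open>A one-way infinite path has a unique first vertex, hence a unique enumeration
  along the path, so it is represented by this enumeration.\<close>

definition graph_rays :: "'v set \<Rightarrow> 'v set set \<Rightarrow> (nat \<Rightarrow> 'v) set" where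
  "graph_rays V E = {R. inj R \<and> range R \<subseteq> V \<and> (\<forall>n. {R n, R (Suc n)} \<in> E)}"

definition separated_by ::
  "'v set \<Rightarrow> 'v set set \<Rightarrow> 'v set \<Rightarrow> (nat \<Rightarrow> 'v) \<Rightarrow> (nat \<Rightarrow> 'v) \<Rightarrow> bool" where
  "separated_by V E F R R' \<longleftrightarrow>
     \<not> (\<exists>C\<in>components_off V E F. \<exists>m n. R ` {m..} \<subseteq> C \<and> R' ` {n..} \<subseteq> C)"

definition ray_equiv :: "'v set \<Rightarrow> 'v set set \<Rightarrow> (nat \<Rightarrow> 'v) rel" where
  "ray_equiv V E =
     {(R, R'). R \<in> graph_rays V E \<and> R' \<in> graph_rays V E \<and>
               (\<forall>F. finite F \<and> F \<subseteq> V \<longrightarrow> \<not> separated_by V E F R R')}"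

definition graph_ends :: "'v set \<Rightarrow> 'v set set \<Rightarrow> (nat \<Rightarrow> 'v) set set" where
  "graph_ends V E = graph_rays V E // ray_equiv V E"

definition basic_open ::
  "'v set \<Rightarrow> 'v set set \<Rightarrow> (nat \<Rightarrow> 'v) set \<Rightarrow> 'v set \<Rightarrow> (nat \<Rightarrow> 'v) set set" where
  "basic_open V E \<epsilon> F =
     {\<eta> \<in> graph_ends V E. \<forall>R\<in>\<epsilon>. \<forall>R'\<in>\<eta>. \<not> separated_by V E F R R'}"

definition end_topology :: "'v set \<Rightarrow> 'v set set \<Rightarrow> (nat \<Rightarrow> 'v) set topology" where
  "end_topology V E =
     topology_generated_by
       {basic_open V E \<epsilon> F | \<epsilon> F. \<epsilon> \<in> graph_ends V E \<and> finite F \<and> F \<subseteq> V}"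

text \<open>HOL cannot quantify existentially over types, so the type from which the vertices of
  the graph are drawn is an explicit parameter.\<close>

definition end_space :: "'v itself \<Rightarrow> 'b topology \<Rightarrow> bool" where
  "end_space _ X \<longleftrightarrow>
     (\<exists>(V :: 'v set) E. simple_graph V E \<and> X homeomorphic_space end_topology V E)"


section \<open>The sets generating the end topology form a base\<close>

lemma adj_off_sym: "sym ((adj_off V E F)\<^sup>*)"
  by (rule sym_rtrancl) (auto simp: adj_off_def sym_def insert_commute)

lemma components_off_disjoint:
  assumes "C \<in> components_off V E F" "D \<in> components_off V E F" "x \<in> C" "x \<in> D"
  shows "C = D"
proof -
  let ?r = "(adj_off V E F)\<^sup>*"
  obtain u v where u: "C = {w. (u, w) \<in> ?r}" and v: "D = {w. (v, w) \<in> ?r}"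
    using assms(1,2) by (auto simp: components_off_def)
  have ux: "(u, x) \<in> ?r" and vx: "(v, x) \<in> ?r" using assms(3,4) u v by auto
  have xu: "(x, u) \<in> ?r" and xv: "(x, v) \<in> ?r"
    using symD[OF adj_off_sym ux] symD[OF adj_off_sym vx] .
  have "(u, w) \<in> ?r \<longleftrightarrow> (v, w) \<in> ?r" for w
    using rtrancl_trans[OF rtrancl_trans[OF ux xv], of w]
      rtrancl_trans[OF rtrancl_trans[OF vx xu], of w] by blast
  then show ?thesis unfolding u v by simp
qed

lemma separated_by_commute: "separated_by V E F R R' = separated_by V E F R' R"
  by (auto simp: separated_by_def)

lemma not_separated_trans:
  assumes "\<not> separated_by V E F R S" "\<not> separated_by V E F S Q"
  shows "\<not> separated_by V E F R Q"
proof -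
  obtain C m n where C: "C \<in> components_off V E F" "R ` {m..} \<subseteq> C" "S ` {n..} \<subseteq> C"
    using assms(1) by (auto simp: separated_by_def)
  obtain D k l where D: "D \<in> components_off V E F" "S ` {k..} \<subseteq> D" "Q ` {l..} \<subseteq> D"
    using assms(2) by (auto simp: separated_by_def)
  have "S (max n k) \<in> C" "S (max n k) \<in> D" using C(3) D(2) by auto
  then have "C = D" using components_off_disjoint C(1) D(1) by metis
  then show ?thesis unfolding separated_by_def using C(1,2) D(3) by blast
qed

lemma components_off_mono:
  assumes "C \<in> components_off V E F'" "F \<subseteq> F'"
  shows "\<exists>D\<in>components_off V E F. C \<subseteq> D"
proof -
  obtain u where u: "u \<in> V - F'" "C = {w. (u, w) \<in> (adj_off V E F')\<^sup>*}"
    using assms(1) by (auto simp: components_off_def)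
  have "adj_off V E F' \<subseteq> adj_off V E F" using assms(2) by (auto simp: adj_off_def)
  then have "C \<subseteq> {w. (u, w) \<in> (adj_off V E F)\<^sup>*}" using u(2) rtrancl_mono by blast
  moreover have "{w. (u, w) \<in> (adj_off V E F)\<^sup>*} \<in> components_off V E F"
    using u(1) assms(2) by (auto simp: components_off_def)
  ultimately show ?thesis by blast
qed

lemma not_separated_mono:
  assumes "\<not> separated_by V E F' R R'" "F \<subseteq> F'"
  shows "\<not> separated_by V E F R R'"
proof -
  obtain C m n where C: "C \<in> components_off V E F'" "R ` {m..} \<subseteq> C" "R' ` {n..} \<subseteq> C"
    using assms(1) by (auto simp: separated_by_def)
  obtain D where "D \<in> components_off V E F" "C \<subseteq> D"
    using components_off_mono[OF C(1) assms(2)] by blast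
  then show ?thesis using C unfolding separated_by_def by (meson order_trans)
qed

lemma ray_not_separated_self:
  assumes R: "R \<in> graph_rays V E" and F: "finite F"
  shows "\<not> separated_by V E F R R"
proof -
  have inj: "inj R" and V: "\<And>n. R n \<in> V" and E: "\<And>n. {R n, R (Suc n)} \<in> E"
    using R by (auto simp: graph_rays_def)
  have "finite (R -` F)" using F inj by (rule finite_vimageI)
  then obtain m where m: "\<And>n. n \<ge> m \<Longrightarrow> R n \<notin> F"
    by (metis finite_nat_set_iff_bounded not_less vimageI)
  have "(R m, R (m + k)) \<in> (adj_off V E F)\<^sup>*" for k
  proof (induction k)
    case (Suc k)
    have "(R (m + k), R (m + Suc k)) \<in> adj_off V E F"
      using m V E by (auto simp: adj_off_def)
    with Suc show ?case by (rule rtrancl_into_rtrancl)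
  qed simp
  then have "R ` {m..} \<subseteq> {w. (R m, w) \<in> (adj_off V E F)\<^sup>*}"
    by (auto simp: le_iff_add)
  moreover have "{w. (R m, w) \<in> (adj_off V E F)\<^sup>*} \<in> components_off V E F"
    using m V by (auto simp: components_off_def)
  ultimately show ?thesis unfolding separated_by_def by blast
qed

lemma equiv_ray_equiv: "equiv (graph_rays V E) (ray_equiv V E)"
proof (rule equivI)
  show "ray_equiv V E \<subseteq> graph_rays V E \<times> graph_rays V E"
    by (auto simp: ray_equiv_def)
  show "refl_on (graph_rays V E) (ray_equiv V E)"
    by (auto simp: refl_on_def ray_equiv_def ray_not_separated_self)
  show "sym (ray_equiv V E)"
    by (auto simp: sym_def ray_equiv_def separated_by_commute)
  show "trans (ray_equiv V E)"
  proof (rule transI)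
    fix R S Q assume "(R, S) \<in> ray_equiv V E" "(S, Q) \<in> ray_equiv V E"
    then show "(R, Q) \<in> ray_equiv V E"
      using not_separated_trans[of V E _ R S Q] by (simp add: ray_equiv_def)
  qed
qed

lemma end_rep:
  assumes "\<epsilon> \<in> graph_ends V E"
  shows "\<exists>R. R \<in> \<epsilon>"
  using in_quotient_imp_non_empty[OF equiv_ray_equiv assms[unfolded graph_ends_def]] by blast

lemma end_not_separated:
  assumes "\<epsilon> \<in> graph_ends V E" "R \<in> \<epsilon>" "R' \<in> \<epsilon>" "finite F" "F \<subseteq> V"
  shows "\<not> separated_by V E F R R'"
proof -
  have "(R, R') \<in> ray_equiv V E"
    using quotient_eq_iff[OF equiv_ray_equiv assms(1,1)[unfolded graph_ends_def] assms(2,3)] by simp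
  with assms(4,5) show ?thesis by (simp add: ray_equiv_def)
qed

lemma basic_open_self:
  assumes "\<epsilon> \<in> graph_ends V E" "finite F" "F \<subseteq> V"
  shows "\<epsilon> \<in> basic_open V E \<epsilon> F"
  using end_not_separated[OF assms(1) _ _ assms(2,3)] assms(1) by (simp add: basic_open_def)

lemma basic_open_shrink:
  assumes "\<eta> \<in> basic_open V E \<epsilon> F" "F \<subseteq> F'"
  shows "basic_open V E \<eta> F' \<subseteq> basic_open V E \<epsilon> F"
proof
  fix \<theta> assume th: "\<theta> \<in> basic_open V E \<eta> F'"
  have "\<eta> \<in> graph_ends V E" using assms(1) by (simp add: basic_open_def)
  then obtain S where S: "S \<in> \<eta>" using end_rep by blast
  have "\<not> separated_by V E F R Q" if "R \<in> \<epsilon>" "Q \<in> \<theta>" for R Q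
  proof (rule not_separated_trans)
    show "\<not> separated_by V E F R S" using assms(1) S that(1) by (auto simp: basic_open_def)
    have "\<not> separated_by V E F' S Q" using th S that(2) by (auto simp: basic_open_def)
    then show "\<not> separated_by V E F S Q" using assms(2) by (rule not_separated_mono)
  qed
  then show "\<theta> \<in> basic_open V E \<epsilon> F" using th by (auto simp: basic_open_def)
qed

lemma openin_end_topology_iff:
  "openin (end_topology V E) U \<longleftrightarrow>
     U \<subseteq> graph_ends V E \<and>
     (\<forall>\<epsilon>\<in>U. \<exists>F. finite F \<and> F \<subseteq> V \<and> basic_open V E \<epsilon> F \<subseteq> U)" (is "_ \<longleftrightarrow> ?rhs U")
proof
  assume "openin (end_topology V E) U"
  then have "generate_topology_on
      {basic_open V E \<epsilon> F | \<epsilon> F. \<epsilon> \<in> graph_ends V E \<and> finite F \<and> F \<subseteq> V} U"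
    by (simp add: end_topology_def openin_topology_generated_by_iff)
  then show "?rhs U"
  proof (induction rule: generate_topology_on.induct)
    case (Int A B)
    have "\<exists>F. finite F \<and> F \<subseteq> V \<and> basic_open V E \<epsilon> F \<subseteq> A \<inter> B" if e: "\<epsilon> \<in> A \<inter> B" for \<epsilon>
    proof -
      obtain F G where F: "finite F" "F \<subseteq> V" "basic_open V E \<epsilon> F \<subseteq> A"
        and G: "finite G" "G \<subseteq> V" "basic_open V E \<epsilon> G \<subseteq> B"
        using Int.IH e by blast
      have e': "\<epsilon> \<in> graph_ends V E" using Int.IH e by blast
      have "basic_open V E \<epsilon> (F \<union> G) \<subseteq> basic_open V E \<epsilon> F \<inter> basic_open V E \<epsilon> G"
        using basic_open_shrink[OF basic_open_self[OF e' F(1,2)], of "F \<union> G"]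
          basic_open_shrink[OF basic_open_self[OF e' G(1,2)], of "F \<union> G"] by auto
      then have "finite (F \<union> G) \<and> F \<union> G \<subseteq> V \<and> basic_open V E \<epsilon> (F \<union> G) \<subseteq> A \<inter> B"
        using F G by auto
      then show ?thesis by (rule exI)
    qed
    then show ?case using Int.IH by blast
  next
    case (UN K)
    show ?case
    proof (intro conjI ballI)
      show "\<Union>K \<subseteq> graph_ends V E" using UN.IH by blast
      fix \<epsilon> assume "\<epsilon> \<in> \<Union>K"
      then obtain k where k: "k \<in> K" "\<epsilon> \<in> k" by blast
      then obtain F where "finite F" "F \<subseteq> V" "basic_open V E \<epsilon> F \<subseteq> k"
        using UN.IH[OF k(1)] by meson
      then show "\<exists>F. finite F \<and> F \<subseteq> V \<and> basic_open V E \<epsilon> F \<subseteq> \<Union>K" using k(1) by blast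
    qed
  next
    case (Basis s)
    then obtain \<epsilon> F where s: "s = basic_open V E \<epsilon> F" "finite F" "F \<subseteq> V" by blast
    have "basic_open V E \<eta> F \<subseteq> s" if "\<eta> \<in> s" for \<eta>
      using basic_open_shrink[OF that[unfolded s(1)] order_refl] s(1) by simp
    moreover have "s \<subseteq> graph_ends V E" using s(1) by (simp add: basic_open_def)
    ultimately show ?case using s(2,3) by blast
  qed simp
next
  assume U: "?rhs U"
  have "\<exists>B. openin (end_topology V E) B \<and> \<epsilon> \<in> B \<and> B \<subseteq> U" if e: "\<epsilon> \<in> U" for \<epsilon>
  proof -
    obtain F where F: "finite F" "F \<subseteq> V" "basic_open V E \<epsilon> F \<subseteq> U" using U e by blast
    have e': "\<epsilon> \<in> graph_ends V E" using U e by blast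
    have "openin (end_topology V E) (basic_open V E \<epsilon> F)"
      unfolding end_topology_def using F(1,2) e'
      by (intro topology_generated_by_Basis) blast
    then show ?thesis using basic_open_self[OF e' F(1,2)] F(3) by (intro exI conjI)
  qed
  then show "openin (end_topology V E) U" using openin_subopen[of "end_topology V E" U] by simp
qed

end

theory Submission
  imports Defs
begin

text \<open>Since \<open>T\<close> is special, there is a norm \<open>nm\<close> with values in the naturals that is injective on
  chains. It yields, around each ray \<open>x\<close>, a partition of the other points into clopen label classes
  such that all but finitely many classes lie in any given neighbourhood of \<open>x\<close>: a ray that does not
  contain \<open>x\<close> is labelled by the element of least norm of \<open>x\<close> that it misses, a ray that extends \<open>x\<close> by
  its least element outside \<open>x\<close>. The norm also makes \<open>X\<close> ultraparacompact.

  In a scattered space, a point \<open>x\<close> isolated in a closed remainder has a clopen neighbourhood that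
  meets the remainder in \<open>x\<close> only. Splitting such neighbourhoods along the label classes and refining by
  ultraparacompactness gives one clopen set \<open>D x\<close> per point; these sets form a forest without infinite
  branches, in which every point has finitely many ancestors. A graph with one ray per point and one
  hub per point and label then has \<open>X\<close> as its end space.\<close>

section \<open>The graph of a labelled forest\<close>

lemma adj_off_closed:
  assumes "(a, b) \<in> (adj_off V E F)\<^sup>*" "a \<in> W"
    and "\<And>a b. a \<in> W \<Longrightarrow> b \<in> V - F \<Longrightarrow> {a, b} \<in> E \<Longrightarrow> b \<in> W"
  shows "b \<in> W"
  using assms(1,2)
proof (induction rule: rtrancl_induct)
  case (step y z)
  then show ?case using assms(3)[of y z] by (auto simp: adj_off_def)
qed

text \<open>A component of the graph minus \<open>F\<close> that meets \<open>W\<close> stays in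
  \<open>W\<close>. Separation is shown below by exhibiting such a set \<open>W\<close> around one
  of the two rays.\<close>

lemma not_separated_closed:
  assumes "\<not> separated_by V E F R R'" "\<And>n. R n \<in> W"
    and "\<And>a b. a \<in> W \<Longrightarrow> b \<in> V - F \<Longrightarrow> {a, b} \<in> E \<Longrightarrow> b \<in> W"
  shows "\<exists>n. R' n \<in> W"
proof -
  obtain C m n where C: "C \<in> components_off V E F" "R ` {m..} \<subseteq> C" "R' ` {n..} \<subseteq> C"
    using assms(1) by (auto simp: separated_by_def)
  obtain u where u: "C = {v. (u, v) \<in> (adj_off V E F)\<^sup>*}"
    using C(1) by (auto simp: components_off_def)
  have 1: "(u, R m) \<in> (adj_off V E F)\<^sup>*" "(u, R' n) \<in> (adj_off V E F)\<^sup>*"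
    using C(2,3) u by auto
  then have "(R m, R' n) \<in> (adj_off V E F)\<^sup>*"
    using symD[OF adj_off_sym 1(1)] by (meson rtrancl_trans)
  then have "R' n \<in> W" by (rule adj_off_closed) (use assms(2,3) in auto)
  then show ?thesis ..
qed

lemma not_separatedI:
  assumes "u \<in> V - F"
    and "\<And>i. i \<ge> m \<Longrightarrow> (u, R i) \<in> (adj_off V E F)\<^sup>*"
    and "\<And>i. i \<ge> n \<Longrightarrow> (u, R' i) \<in> (adj_off V E F)\<^sup>*"
  shows "\<not> separated_by V E F R R'"
proof -
  have "{v. (u, v) \<in> (adj_off V E F)\<^sup>*} \<in> components_off V E F"
    using assms(1) by (auto simp: components_off_def)
  moreover have "R ` {m..} \<subseteq> {v. (u, v) \<in> (adj_off V E F)\<^sup>*}" using assms(2) by auto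
  moreover have "R' ` {n..} \<subseteq> {v. (u, v) \<in> (adj_off V E F)\<^sup>*}" using assms(3) by auto
  ultimately show ?thesis unfolding separated_by_def by blast
qed

lemma path_adj_off:
  assumes "\<And>i. i \<ge> m \<Longrightarrow> R i \<in> V - F" "\<And>i. {R i, R (Suc i)} \<in> E" "m \<le> n"
  shows "(R m, R n) \<in> (adj_off V E F)\<^sup>*"
  using assms(3)
proof (induction n rule: dec_induct)
  case (step n)
  have "(R n, R (Suc n)) \<in> adj_off V E F"
    using assms(1)[of n] assms(1)[of "Suc n"] assms(2) step.hyps by (auto simp: adj_off_def)
  with step.IH show ?case by (rule rtrancl_into_rtrancl)
qed simp

text \<open>A graph whose end space is \<open>X\<close>: every point \<open>x\<close> carries a ray \<open>rv x\<close> and, for each label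
  \<open>l\<close>, a hub \<open>hv x l\<close> joined to the whole ray. The sets \<open>D x\<close> form a forest under inclusion, and the
  first vertex of \<open>rv y\<close> is joined to the hub with label \<open>lab x y\<close> of every ancestor \<open>x\<close> of \<open>y\<close>. So a
  finite vertex set cuts only finitely many labels off from the end of \<open>x\<close>.\<close>

locale labelled_forest =
  fixes X :: "'p topology" and D :: "'p \<Rightarrow> 'p set" and lab :: "'p \<Rightarrow> 'p \<Rightarrow> 'l"
    and rv :: "'p \<Rightarrow> nat \<Rightarrow> 'v" and hv :: "'p \<Rightarrow> 'l \<Rightarrow> 'v"
  assumes D_self: "x \<in> topspace X \<Longrightarrow> x \<in> D x"
    and D_sub: "x \<in> topspace X \<Longrightarrow> D x \<subseteq> topspace X"
    and nest: "\<lbrakk>x \<in> topspace X; y \<in> D x; y \<noteq> x; z \<in> D y\<rbrakk> \<Longrightarrow> z \<in> D x \<and> z \<noteq> x \<and> lab x z = lab x y"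
    and forest: "\<lbrakk>x \<in> topspace X; z \<in> topspace X; y \<in> D x; y \<in> D z\<rbrakk> \<Longrightarrow> x \<in> D z \<or> z \<in> D x"
    and fin_anc: "y \<in> topspace X \<Longrightarrow> finite {x \<in> topspace X. y \<in> D x}"
    and wf_D: "wf {(y, x). x \<in> topspace X \<and> y \<in> D x \<and> y \<noteq> x}"
    and open_iff: "openin X U \<longleftrightarrow> U \<subseteq> topspace X \<and>
      (\<forall>x\<in>U. \<exists>H. finite H \<and> {y \<in> D x. y = x \<or> lab x y \<notin> H} \<subseteq> U)"
    and rv_inj: "\<lbrakk>x \<in> topspace X; y \<in> topspace X; rv x m = rv y n\<rbrakk> \<Longrightarrow> x = y \<and> m = n"
    and hv_inj: "\<lbrakk>x \<in> topspace X; y \<in> topspace X; hv x k = hv y l\<rbrakk> \<Longrightarrow> x = y \<and> k = l"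
    and rv_hv: "\<lbrakk>x \<in> topspace X; y \<in> topspace X\<rbrakk> \<Longrightarrow> rv x m \<noteq> hv y l"
begin

abbreviation "S \<equiv> topspace X"

definition fib :: "'p \<Rightarrow> 'v set" where
  "fib x = range (rv x) \<union> range (hv x)"

definition V :: "'v set" where
  "V = (\<Union>x\<in>S. fib x)"

inductive edge :: "'v \<Rightarrow> 'v \<Rightarrow> bool" where
  path: "x \<in> S \<Longrightarrow> edge (rv x n) (rv x (Suc n))"
| hub: "x \<in> S \<Longrightarrow> edge (rv x n) (hv x l)"
| child: "x \<in> S \<Longrightarrow> y \<in> D x \<Longrightarrow> y \<noteq> x \<Longrightarrow> edge (rv y 0) (hv x (lab x y))"

definition E :: "'v set set" where
  "E = {{a, b} | a b. edge a b}"

lemma E_cases: "{a, b} \<in> E \<Longrightarrow> edge a b \<or> edge b a"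
  by (auto simp: E_def doubleton_eq_iff)

lemma E_I: "edge a b \<Longrightarrow> {a, b} \<in> E" "edge a b \<Longrightarrow> {b, a} \<in> E"
  by (auto simp: E_def doubleton_eq_iff)

lemma rv_V: "x \<in> S \<Longrightarrow> rv x n \<in> V" and hv_V: "x \<in> S \<Longrightarrow> hv x l \<in> V"
  by (auto simp: V_def fib_def)

lemma D_S: "x \<in> S \<Longrightarrow> y \<in> D x \<Longrightarrow> y \<in> S"
  using D_sub by blast

lemma rv_fib: "rv x n \<in> fib x" and hv_fib: "hv x l \<in> fib x"
  by (auto simp: fib_def)

lemma fib_disj: "x \<in> S \<Longrightarrow> y \<in> S \<Longrightarrow> a \<in> fib x \<Longrightarrow> a \<in> fib y \<Longrightarrow> x = y"
  unfolding fib_def using rv_inj hv_inj rv_hv by (auto; metis)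

lemma simple_graph_V_E: "simple_graph V E"
proof -
  have "{a, b} \<subseteq> V \<and> card {a, b} = 2" if "edge a b" for a b
    using that
  proof cases
    case (path x n)
    moreover have "rv x n \<noteq> rv x (Suc n)" using path rv_inj[of x x n "Suc n"] by auto
    ultimately show ?thesis using rv_V by simp
  next
    case (hub x n l)
    then show ?thesis using rv_V hv_V rv_hv[of x x n l] by auto
  next
    case (child x y)
    then show ?thesis using rv_V hv_V rv_hv[of y x 0 "lab x y"] D_S by auto
  qed
  then show ?thesis unfolding simple_graph_def E_def by blast
qed

section \<open>The rays \<open>rv x\<close> and the neighbourhoods of their ends\<close>

lemma rv_ray: "x \<in> S \<Longrightarrow> rv x \<in> graph_rays V E"
  unfolding graph_rays_def using rv_V rv_inj E_I(1)[OF path] by (auto simp: inj_def)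

text \<open>For a proper ancestor \<open>z\<close> of \<open>x\<close> one hub of \<open>z\<close>
  suffices: by \<open>nest\<close>, all points of \<open>D x\<close> have the same label at
  \<open>z\<close> as \<open>x\<close> and so are joined to that hub only. As \<open>x\<close> has
  finitely many ancestors, the set is finite for finite \<open>H\<close>.\<close>

definition cut :: "'p \<Rightarrow> 'l set \<Rightarrow> 'v set" where
  "cut x H = hv x ` H \<union> (\<lambda>z. hv z (lab z x)) ` {z \<in> S. x \<in> D z \<and> z \<noteq> x}"

definition nb :: "'p \<Rightarrow> 'l set \<Rightarrow> 'p set" where
  "nb x H = {y \<in> D x. y = x \<or> lab x y \<notin> H}"

lemma finite_cut: "x \<in> S \<Longrightarrow> finite H \<Longrightarrow> finite (cut x H) \<and> cut x H \<subseteq> V"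
  unfolding cut_def using hv_V by (auto intro!: finite_imageI finite_subset[OF _ fin_anc[of x]])

text \<open>Only \<open>child\<close> edges change the fibre. Downwards from \<open>x\<close> the
  label is outside \<open>H\<close>, since the hub was not removed; further down \<open>nest\<close>
  keeps it. Upwards from \<open>y\<close> to \<open>z\<close>, either \<open>z\<close> is in
  \<open>nb x H\<close>, or \<open>z\<close> is a proper ancestor of \<open>x\<close> and the hub
  reached is in the cut.\<close>

lemma cut_closed:
  assumes x: "x \<in> S" and a: "a \<in> (\<Union>y\<in>nb x H. fib y) - hv x ` H"
    and b: "b \<in> V - cut x H" and e: "{a, b} \<in> E"
  shows "b \<in> (\<Union>y\<in>nb x H. fib y) - hv x ` H"
proof -
  obtain y where y: "y \<in> nb x H" "a \<in> fib y" "a \<notin> hv x ` H" using a by blast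
  have yD: "y \<in> D x" and yS: "y \<in> S" using y x D_S by (auto simp: nb_def)
  have bH: "b \<notin> hv x ` H" using b by (auto simp: cut_def)
  have "\<exists>z\<in>nb x H. b \<in> fib z"
    using E_cases[OF e]
  proof
    assume "edge a b"
    then show ?thesis
    proof cases
      case (path z n)
      then show ?thesis using fib_disj[of z y a] y yS rv_fib by auto
    next
      case (hub z n l)
      then have "z = y" using fib_disj[of z y a] y yS rv_fib hv_fib by auto
      then show ?thesis using y hub rv_fib hv_fib by blast
    next
      case (child z w)
      have w: "w = y" using fib_disj[of w y a] y yS child D_S rv_fib by auto
      show ?thesis
      proof (cases "y = x")
        case True
        then show ?thesis using child w b by (auto simp: cut_def)
      next
        case False
        have z: "z \<in> nb x H"
        proof (cases "z \<in> D x")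
          case True
          show ?thesis
          proof (cases "z = x")
            case True
            then show ?thesis using D_self x by (auto simp: nb_def)
          next
            case zx: False
            then have "lab x y = lab x z" using nest[of x z y] x True child w by auto
            then show ?thesis using y True False by (auto simp: nb_def)
          qed
        next
          case nz: False
          then have xz: "x \<in> D z" using forest[of x z y] x child w yD by auto
          moreover have "x \<noteq> z" using nz D_self x by auto
          ultimately have "lab z y = lab z x" using nest[of z x y] child yD by auto
          then have "b \<in> cut x H" unfolding cut_def using child w xz \<open>x \<noteq> z\<close> by auto
          then show ?thesis using b by auto
        qed
        then show ?thesis using child hv_fib by blast
      qed
    qed
  next
    assume "edge b a"
    then show ?thesis
    proof cases
      case (path z n)
      then show ?thesis using fib_disj[of z y a] y yS rv_fib by auto
    next
      case (hub z n l)
      then have "z = y" using fib_disj[of z y a] y yS rv_fib hv_fib by auto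
      then show ?thesis using y hub rv_fib hv_fib by blast
    next
      case (child z w)
      have z: "z = y" using fib_disj[of z y a] y yS child hv_fib by auto
      have "w \<in> nb x H"
      proof (cases "y = x")
        case True
        then show ?thesis using child z y by (auto simp: nb_def)
      next
        case False
        then show ?thesis using nest[of x y w] x yD child z y by (auto simp: nb_def)
      qed
      then show ?thesis using child rv_fib by blast
    qed
  qed
  then show ?thesis using bH by blast
qed

lemma not_separated_cut:
  assumes x: "x \<in> S" and y: "y \<in> S" and n: "\<not> separated_by V E (cut x H) (rv x) (rv y)"
  shows "y \<in> nb x H"
proof -
  have "x \<in> nb x H" using D_self x by (auto simp: nb_def)
  then have "rv x n \<in> (\<Union>y\<in>nb x H. fib y) - hv x ` H" for n
    using rv_hv[of x x n] x rv_fib by blast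
  then obtain k where "rv y k \<in> (\<Union>y\<in>nb x H. fib y) - hv x ` H"
    using not_separated_closed[OF n, where W = "(\<Union>y\<in>nb x H. fib y) - hv x ` H"] cut_closed[OF x]
    by metis
  then obtain z where z: "z \<in> nb x H" "rv y k \<in> fib z" by blast
  then have "z \<in> S" using x D_S by (auto simp: nb_def)
  then have "z = y" using fib_disj[OF _ y z(2) rv_fib] by blast
  then show ?thesis using z by simp
qed

lemma rv_tail:
  assumes "x \<in> S" "finite F"
  shows "\<exists>N. \<forall>n\<ge>N. rv x n \<notin> F"
proof -
  have "inj (rv x)" using rv_inj assms by (auto simp: inj_def)
  then have "finite (rv x -` F)" using assms(2) finite_vimageI by blast
  then obtain N where "\<forall>n\<in>rv x -` F. n < N" using finite_nat_set_iff_bounded by blast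
  then show ?thesis by (metis leD vimageI)
qed

lemma rv_conn:
  assumes "x \<in> S" "\<And>n. n \<ge> N \<Longrightarrow> rv x n \<notin> F" "N \<le> n"
  shows "(rv x N, rv x n) \<in> (adj_off V E F)\<^sup>*"
  by (rule path_adj_off) (use assms rv_V E_I path in auto)

text \<open>\<open>H\<close> collects the labels of the hubs of \<open>x\<close> in \<open>F\<close>
  and of the points whose fibre meets \<open>F\<close>; a vertex is in at most one fibre, so
  \<open>H\<close> is finite. A point with label outside \<open>H\<close> keeps its whole fibre and
  is joined to a tail of \<open>rv x\<close> through one surviving hub.\<close>

lemma not_separated_nb:
  assumes x: "x \<in> S" and F: "finite F" "F \<subseteq> V"
  shows "\<exists>H. finite H \<and> (\<forall>y\<in>nb x H. \<not> separated_by V E F (rv x) (rv y))"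
proof -
  define H where "H = {l. hv x l \<in> F} \<union> lab x ` {y \<in> S. fib y \<inter> F \<noteq> {}}"
  have "finite {l. hv x l \<in> F}"
    using finite_vimageI[OF F(1), of "hv x"] hv_inj[OF x x] by (auto simp: inj_def vimage_def)
  moreover have "finite {y \<in> S. fib y \<inter> F \<noteq> {}}"
  proof -
    have "\<forall>a\<in>F. finite {y \<in> S. a \<in> fib y}"
    proof
      fix a
      have "{y \<in> S. a \<in> fib y} \<subseteq> {SOME y. y \<in> S \<and> a \<in> fib y}"
        using fib_disj by (auto intro: someI2)
      then show "finite {y \<in> S. a \<in> fib y}" by (rule finite_subset) simp
    qed
    then have "finite (\<Union>a\<in>F. {y \<in> S. a \<in> fib y})" using F by blast
    then show ?thesis by (rule rev_finite_subset) auto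
  qed
  ultimately have H: "finite H" by (simp add: H_def)
  have "\<not> separated_by V E F (rv x) (rv y)" if y: "y \<in> nb x H" for y
  proof (cases "y = x")
    case True
    then show ?thesis using ray_not_separated_self rv_ray x F by metis
  next
    case False
    have yD: "y \<in> D x" and yS: "y \<in> S" and l: "lab x y \<notin> H"
      using y False x D_S by (auto simp: nb_def)
    have yF: "fib y \<inter> F = {}" and hF: "hv x (lab x y) \<notin> F"
      using l yS by (auto simp: H_def)
    obtain N where N: "\<forall>n\<ge>N. rv x n \<notin> F" using rv_tail[OF x F(1)] by blast
    let ?A = "adj_off V E F"
    have y0: "rv y n \<notin> F" for n using yF rv_fib by blast
    have 1: "(rv x N, hv x (lab x y)) \<in> ?A"
      using N hF x rv_V hv_V E_I hub by (auto simp: adj_off_def)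
    have 2: "(hv x (lab x y), rv y 0) \<in> ?A"
      using y0 hF x yS rv_V hv_V E_I child[OF x yD False] by (auto simp: adj_off_def)
    have 3: "(rv x N, rv y 0) \<in> ?A\<^sup>*" using 1 2 by auto
    show ?thesis
    proof (rule not_separatedI)
      show "rv x N \<in> V - F" using N x rv_V by auto
      show "(rv x N, rv x i) \<in> ?A\<^sup>*" if "N \<le> i" for i
        using rv_conn[OF x _ that] N by blast
      show "(rv x N, rv y i) \<in> ?A\<^sup>*" if "0 \<le> i" for i
        using rtrancl_trans[OF 3 rv_conn[OF yS _ that]] y0 by blast
    qed
  qed
  then show ?thesis using H by blast
qed

section \<open>Every ray of the graph belongs to the end of a point\<close>

text \<open>Passing to a proper ancestor strictly lowers the finite number of ancestors, so a member
  of \<open>B\<close> above \<open>y\<close> with fewest ancestors is maximal.\<close>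

lemma maximal_ancestor:
  assumes "B \<subseteq> S" "y \<in> B"
  shows "\<exists>m\<in>B. y \<in> D m \<and> (\<forall>z\<in>B. m \<in> D z \<longrightarrow> z = m)"
proof -
  let ?c = "\<lambda>m. card {x \<in> S. m \<in> D x}"
  have "y \<in> B \<and> y \<in> D y" using assms D_self by blast
  then obtain m where m: "m \<in> B" "y \<in> D m" and min: "\<And>z. z \<in> B \<Longrightarrow> y \<in> D z \<Longrightarrow> ?c m \<le> ?c z"
    using ex_has_least_nat[of "\<lambda>m. m \<in> B \<and> y \<in> D m" y ?c] by blast
  have "z = m" if z: "z \<in> B" "m \<in> D z" for z
  proof (rule ccontr)
    assume ne: "z \<noteq> m"
    have zS: "z \<in> S" "m \<in> S" using z m assms by auto
    have yz: "y \<in> D z" using nest[OF zS(1) z(2) _ m(2)] ne by auto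
    have "{x \<in> S. z \<in> D x} \<subset> {x \<in> S. m \<in> D x}"
    proof
      show "{x \<in> S. z \<in> D x} \<subseteq> {x \<in> S. m \<in> D x}"
      proof
        fix x assume "x \<in> {x \<in> S. z \<in> D x}"
        then show "x \<in> {x \<in> S. m \<in> D x}" using nest[of x z m] z by (cases "x = z") auto
      qed
      have "m \<in> {x \<in> S. m \<in> D x}" "m \<notin> {x \<in> S. z \<in> D x}"
        using zS D_self nest[OF zS(1) z(2), of z] ne by auto
      then show "{x \<in> S. z \<in> D x} \<noteq> {x \<in> S. m \<in> D x}" by blast
    qed
    then have "?c z < ?c m" by (intro psubset_card_mono fin_anc zS)
    then show False using min[OF z(1) yz] by simp
  qed
  then show ?thesis using m by blast
qed

text \<open>Adjacent vertices belong to comparable points, and by \<open>forest\<close> an ancestor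
  of a member of \<open>D m\<close> is in \<open>D m\<close> or above \<open>m\<close>.\<close>

lemma edge_step:
  assumes m: "m \<in> S" and p: "p \<in> D m" "a \<in> fib p" and q: "q \<in> S" "b \<in> fib q" and e: "{a, b} \<in> E"
  shows "q \<in> D m \<or> (m \<in> D q \<and> q \<noteq> m)"
proof -
  have pS: "p \<in> S" using D_S m p by blast
  have "p = q \<or> (p \<in> D q \<and> p \<noteq> q) \<or> (q \<in> D p \<and> p \<noteq> q)"
    using E_cases[OF e]
  proof
    assume "edge a b"
    then show ?thesis
    proof cases
      case (path z n)
      then show ?thesis using fib_disj[of z _ a] fib_disj[of z _ b] p pS q rv_fib by metis
    next
      case (hub z n l)
      then show ?thesis using fib_disj[of z _ a] fib_disj[of z _ b] p pS q rv_fib hv_fib by metis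
    next
      case (child z w)
      then have "z = q" "w = p"
        using fib_disj[of z q b] fib_disj[of w p a] p pS q rv_fib hv_fib D_S by blast+
      then show ?thesis using child by auto
    qed
  next
    assume "edge b a"
    then show ?thesis
    proof cases
      case (path z n)
      then show ?thesis using fib_disj[of z _ a] fib_disj[of z _ b] p pS q rv_fib by metis
    next
      case (hub z n l)
      then show ?thesis using fib_disj[of z _ a] fib_disj[of z _ b] p pS q rv_fib hv_fib by metis
    next
      case (child z w)
      then have "z = p" "w = q"
        using fib_disj[of z p a] fib_disj[of w q b] p pS q rv_fib hv_fib D_S by blast+
      then show ?thesis using child by auto
    qed
  qed
  then show ?thesis
    using forest[OF m q(1) p(1)] nest[of m p q] D_self[of m] m p q by blast
qed

text \<open>Track the points \<open>p i\<close> whose fibres the ray visits. By \<open>wf_D\<close>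
  there is a deepest \<open>x\<close> such that the ray is eventually over \<open>D x\<close>; its
  fibre is visited infinitely often, and late visits are joined to a tail of
  \<open>rv x\<close>.\<close>

lemma every_ray:
  assumes Q: "Q \<in> graph_rays V E"
  shows "\<exists>x\<in>S. (rv x, Q) \<in> ray_equiv V E"
proof -
  have inj: "inj Q" and QV: "\<And>i. Q i \<in> V" and QE: "\<And>i. {Q i, Q (Suc i)} \<in> E"
    using Q by (auto simp: graph_rays_def)
  have "\<forall>i. \<exists>p. p \<in> S \<and> Q i \<in> fib p" using QV by (auto simp: V_def)
  then obtain p where p: "\<And>i. p i \<in> S" "\<And>i. Q i \<in> fib (p i)" by metis
  have p_step: "p (Suc i) \<in> D m \<or> (m \<in> D (p (Suc i)) \<and> p (Suc i) \<noteq> m)"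
    if "m \<in> S" "p i \<in> D m" for m i
    using edge_step[OF that p(2) p(1) p(2) QE] .
  define A where "A = {x \<in> S. \<exists>k. \<forall>i\<ge>k. p i \<in> D x}"
  \<comment> \<open>As \<open>m\<close> is maximal in \<open>B\<close>, a path that remains over
    \<open>B\<close> cannot move to a proper ancestor of \<open>m\<close> and is trapped over
    \<open>D m\<close>.\<close>
  have stay: "m \<in> A" if B: "B \<subseteq> S" "m \<in> B" "p k \<in> D m" "\<And>i. i \<ge> k \<Longrightarrow> p i \<in> B"
    and max: "\<forall>z\<in>B. m \<in> D z \<longrightarrow> z = m" for B m k
  proof -
    have "p i \<in> D m" if "k \<le> i" for i
      using that
    proof (induction i rule: dec_induct)
      case (step i)
      have "p (Suc i) \<in> B" using B(4)[of "Suc i"] step.hyps by simp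
      then show ?case using p_step[of m i] step.IH B max by auto
    qed (use B in auto)
    then show ?thesis using B by (auto simp: A_def)
  qed
  obtain m where "m \<in> S" "p 0 \<in> D m" "\<forall>z\<in>S. m \<in> D z \<longrightarrow> z = m"
    using maximal_ancestor[of S "p 0"] p by blast
  then have "m \<in> A" using stay[of S m 0] p(1) by simp
  then obtain x where x: "x \<in> A"
    and xmin: "\<And>y. (y, x) \<in> {(y, x). x \<in> S \<and> y \<in> D x \<and> y \<noteq> x} \<Longrightarrow> y \<notin> A"
    using wfE_min[OF wf_D, of _ A] by blast
  have xS: "x \<in> S" using x by (auto simp: A_def)
  have inf: "\<exists>i\<ge>k. p i = x" for k
  proof (rule ccontr)
    assume no: "\<not> (\<exists>i\<ge>k. p i = x)"
    obtain k' where "\<And>i. i \<ge> k' \<Longrightarrow> p i \<in> D x" using x by (auto simp: A_def)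
    then have k: "p i \<in> D x - {x}" if "i \<ge> max k k'" for i using no that by auto
    have B: "D x - {x} \<subseteq> S" using D_S xS by blast
    \<comment> \<open>A maximal proper descendant of \<open>x\<close> would trap the tail, against
      the minimality of \<open>x\<close>.\<close>
    obtain m where m: "m \<in> D x - {x}" "p (max k k') \<in> D m" "\<forall>z\<in>D x - {x}. m \<in> D z \<longrightarrow> z = m"
      using maximal_ancestor[OF B k[OF order_refl]] by blast
    have "m \<in> A" by (rule stay[OF B m(1) m(2) k m(3)])
    then show False using xmin[of m] m xS by auto
  qed
  have "\<not> separated_by V E F (rv x) Q" if F: "finite F" "F \<subseteq> V" for F
  proof -
    obtain N where N: "\<And>n. n \<ge> N \<Longrightarrow> rv x n \<notin> F" using rv_tail[OF xS F(1)] by blast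
    \<comment> \<open>The initial segment of \<open>rv x\<close> is avoided too, so that late visits
      to \<open>rv x\<close> hit the tail that is disjoint from \<open>F\<close>.\<close>
    have "finite (Q -` (F \<union> rv x ` {..N}))" using inj F by (intro finite_vimageI) auto
    then obtain k where "\<forall>i\<in>Q -` (F \<union> rv x ` {..N}). i < k"
      using finite_nat_set_iff_bounded by blast
    then have k: "Q i \<notin> F \<union> rv x ` {..N}" if "i \<ge> k" for i using that by (meson leD vimageI)
    obtain i where i: "i \<ge> k" "p i = x" using inf by blast
    let ?A = "adj_off V E F"
    have 1: "(rv x N, Q i) \<in> ?A\<^sup>*"
    proof -
      consider n where "Q i = rv x n" | l where "Q i = hv x l" using p(2)[of i] i(2) by (auto simp: fib_def)
      then show ?thesis
      proof cases
        case 1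
        then have "n \<ge> N" using k[OF i(1)] by (metis UnI2 atMost_iff imageI linorder_le_cases)
        then show ?thesis using rv_conn[OF xS N] 1 by simp
      next
        case 2
        have "(rv x N, hv x l) \<in> ?A"
          using k[OF i(1)] N[of N] 2 xS rv_V hv_V E_I hub by (auto simp: adj_off_def)
        then show ?thesis using 2 by auto
      qed
    qed
    show ?thesis
    proof (rule not_separatedI)
      show "rv x N \<in> V - F" using N xS rv_V by auto
      show "(rv x N, rv x j) \<in> ?A\<^sup>*" if "N \<le> j" for j
        using rv_conn[OF xS N that] .
      show "(rv x N, Q j) \<in> ?A\<^sup>*" if "i \<le> j" for j
        by (rule rtrancl_trans[OF 1], rule path_adj_off) (use QV QE k i that in auto)
    qed
  qed
  then show ?thesis using Q rv_ray xS by (auto simp: ray_equiv_def)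
qed

section \<open>The homeomorphism onto the end space\<close>

definition end_of :: "'p \<Rightarrow> (nat \<Rightarrow> 'v) set" where
  "end_of x = ray_equiv V E `` {rv x}"

lemma end_of_ends: "x \<in> S \<Longrightarrow> end_of x \<in> graph_ends V E"
  unfolding end_of_def graph_ends_def using rv_ray by (auto intro: quotientI)

lemma rv_end_of: "x \<in> S \<Longrightarrow> rv x \<in> end_of x"
  unfolding end_of_def using rv_ray equiv_class_self[OF equiv_ray_equiv] by metis

lemma inj_end_of: "inj_on end_of S"
proof (rule inj_onI, rule ccontr)
  fix x y assume xy: "x \<in> S" "y \<in> S" "end_of x = end_of y" "x \<noteq> y"
  \<comment> \<open>This cut separates the two rays because \<open>nb x {lab x y}\<close> misses
    \<open>y\<close>.\<close>
  let ?F = "cut x {lab x y}"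
  have "rv y \<in> end_of x" using rv_end_of xy by metis
  then have "\<not> separated_by V E ?F (rv x) (rv y)"
    using end_not_separated[OF end_of_ends[OF xy(1)] rv_end_of[OF xy(1)]] finite_cut[OF xy(1)] by simp
  then show False using not_separated_cut[of x y "{lab x y}"] xy by (auto simp: nb_def)
qed

lemma range_end_of: "end_of ` S = graph_ends V E"
proof
  show "graph_ends V E \<subseteq> end_of ` S"
  proof
    fix e assume "e \<in> graph_ends V E"
    then obtain Q where Q: "Q \<in> graph_rays V E" "e = ray_equiv V E `` {Q}"
      unfolding graph_ends_def by (auto elim: quotientE)
    then obtain x where x: "x \<in> S" "(rv x, Q) \<in> ray_equiv V E" using every_ray by blast
    then have "e = end_of x"
      unfolding end_of_def Q(2) by (intro equiv_class_eq[OF equiv_ray_equiv, symmetric])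
    then show "e \<in> end_of ` S" using x(1) by simp
  qed
qed (use end_of_ends in auto)

lemma basic_open_end_of:
  assumes "x \<in> S" "y \<in> S" "finite F" "F \<subseteq> V"
  shows "end_of y \<in> basic_open V E (end_of x) F \<longleftrightarrow> \<not> separated_by V E F (rv x) (rv y)"
proof
  assume "end_of y \<in> basic_open V E (end_of x) F"
  then show "\<not> separated_by V E F (rv x) (rv y)"
    using rv_end_of assms by (auto simp: basic_open_def)
next
  assume n: "\<not> separated_by V E F (rv x) (rv y)"
  have "\<not> separated_by V E F R R'" if "R \<in> end_of x" "R' \<in> end_of y" for R R'
    by (rule not_separated_trans[OF not_separated_trans[OF _ n]];
        rule end_not_separated[OF end_of_ends]) (use that rv_end_of assms in auto)
  then show "end_of y \<in> basic_open V E (end_of x) F"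
    using end_of_ends assms by (auto simp: basic_open_def)
qed

text \<open>The two neighbourhood bases refine each other: \<open>not_separated_nb\<close> turns a
  finite vertex set into finitely many labels, \<open>not_separated_cut\<close> turns finitely many
  labels into a cut.\<close>

lemma openin_end_of:
  assumes U: "U \<subseteq> S"
  shows "openin (end_topology V E) (end_of ` U) \<longleftrightarrow> openin X U"
proof -
  have "(\<exists>F. finite F \<and> F \<subseteq> V \<and> basic_open V E (end_of x) F \<subseteq> end_of ` U) \<longleftrightarrow>
        (\<exists>H. finite H \<and> nb x H \<subseteq> U)" if x: "x \<in> U" for x
  proof
    assume "\<exists>F. finite F \<and> F \<subseteq> V \<and> basic_open V E (end_of x) F \<subseteq> end_of ` U"
    then obtain F where F: "finite F" "F \<subseteq> V" "basic_open V E (end_of x) F \<subseteq> end_of ` U" by blast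
    obtain H where H: "finite H" "\<forall>y\<in>nb x H. \<not> separated_by V E F (rv x) (rv y)"
      using not_separated_nb[OF subsetD[OF U x] F(1,2)] by auto
    have "y \<in> U" if y: "y \<in> nb x H" for y
    proof -
      have yS: "y \<in> S" using y x U D_S by (auto simp: nb_def)
      then have "end_of y \<in> end_of ` U" using F H y basic_open_end_of[of x y F] x U by blast
      then show ?thesis using inj_onD[OF inj_end_of] yS U by blast
    qed
    then show "\<exists>H. finite H \<and> nb x H \<subseteq> U" using H by blast
  next
    assume "\<exists>H. finite H \<and> nb x H \<subseteq> U"
    then obtain H where H: "finite H" "nb x H \<subseteq> U" by blast
    have xS: "x \<in> S" using x U by blast
    have "basic_open V E (end_of x) (cut x H) \<subseteq> end_of ` U"
    proof
      fix e assume e: "e \<in> basic_open V E (end_of x) (cut x H)"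
      then obtain y where y: "y \<in> S" "e = end_of y"
        unfolding basic_open_def range_end_of[symmetric] by auto
      then show "e \<in> end_of ` U"
        using e basic_open_end_of[OF xS y(1), of "cut x H"] finite_cut[OF xS H(1)]
          not_separated_cut[OF xS y(1), of H] H(2) by auto
    qed
    then show "\<exists>F. finite F \<and> F \<subseteq> V \<and> basic_open V E (end_of x) F \<subseteq> end_of ` U"
      using finite_cut[OF xS H(1)] by metis
  qed
  moreover have "end_of ` U \<subseteq> graph_ends V E" using U end_of_ends by blast
  ultimately show ?thesis
    unfolding openin_end_topology_iff open_iff nb_def using U by auto
qed

lemma homeomorphic_end_topology: "X homeomorphic_space end_topology V E"
proof -
  have ts: "topspace (end_topology V E) = graph_ends V E"
  proof
    show "topspace (end_topology V E) \<subseteq> graph_ends V E"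
      using openin_end_topology_iff openin_topspace by blast
    have "openin (end_topology V E) (graph_ends V E)"
      unfolding openin_end_topology_iff by (auto simp: basic_open_def intro!: exI[of _ "{}"])
    then show "graph_ends V E \<subseteq> topspace (end_topology V E)" by (rule openin_subset)
  qed
  have "openin X {x \<in> S. end_of x \<in> U} \<longleftrightarrow> openin (end_topology V E) U"
    if "U \<subseteq> graph_ends V E" for U
  proof -
    have "end_of ` {x \<in> S. end_of x \<in> U} = U" using that unfolding range_end_of[symmetric] by auto
    then show ?thesis using openin_end_of[of "{x \<in> S. end_of x \<in> U}"] by auto
  qed
  then have "homeomorphic_map X (end_topology V E) end_of"
    unfolding homeomorphic_map_def quotient_map_def ts using range_end_of inj_end_of by simp
  then show ?thesis using homeomorphic_map_imp_homeomorphic_space by blast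
qed

end

section \<open>Scattered ultraparacompact spaces\<close>

text \<open>A refinement of the cover by pairwise disjoint open sets is given as a function:
  \<open>P x\<close> is the cell of \<open>x\<close>. Forests on the cells can then be glued along
  \<open>P\<close>.\<close>

definition ultraparacompact_space :: "'p topology \<Rightarrow> bool" where
  "ultraparacompact_space X \<longleftrightarrow>
     (\<forall>\<U>. (\<forall>U\<in>\<U>. openin X U) \<and> topspace X \<subseteq> \<Union>\<U> \<longrightarrow>
        (\<exists>P. \<forall>x\<in>topspace X. x \<in> P x \<and> openin X (P x) \<and> (\<forall>y\<in>P x. P y = P x) \<and> (\<exists>U\<in>\<U>. P x \<subseteq> U)))"

lemma closedin_partition:
  assumes P: "\<And>x. x \<in> topspace X \<Longrightarrow> x \<in> P x \<and> openin X (P x) \<and> (\<forall>y\<in>P x. P y = P x)"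
    and x: "x \<in> topspace X"
  shows "closedin X (P x)"
proof -
  have "topspace X - P x = (\<Union>y\<in>topspace X - P x. P y)"
  proof
    show "topspace X - P x \<subseteq> (\<Union>y\<in>topspace X - P x. P y)" using P by auto
    show "(\<Union>y\<in>topspace X - P x. P y) \<subseteq> topspace X - P x"
    proof
      fix z assume "z \<in> (\<Union>y\<in>topspace X - P x. P y)"
      then obtain y where y: "y \<in> topspace X" "y \<notin> P x" "z \<in> P y" by auto
      have "z \<in> topspace X" using P[OF y(1)] y(3) openin_subset by blast
      moreover have "z \<notin> P x" using P[OF y(1)] P[OF x] y by metis
      ultimately show "z \<in> topspace X - P x" by blast
    qed
  qed
  moreover have "openin X (\<Union>y\<in>topspace X - P x. P y)" using P by auto
  ultimately show ?thesis using P[OF x] openin_subset[of X "P x"] unfolding closedin_def by metis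
qed

locale labelled_space =
  fixes X :: "'p topology" and lab :: "'p \<Rightarrow> 'p \<Rightarrow> 'l"
  assumes label_clopen: "x \<in> topspace X \<Longrightarrow>
      openin X {y \<in> topspace X. y \<noteq> x \<and> lab x y = l} \<and> closedin X {y \<in> topspace X. y \<noteq> x \<and> lab x y = l}"
    and label_base: "openin X U \<Longrightarrow> x \<in> U \<Longrightarrow>
      \<exists>H. finite H \<and> {y \<in> topspace X. y = x \<or> lab x y \<notin> H} \<subseteq> U"
begin

section \<open>Forests over subsets of the space\<close>

text \<open>The axioms of \<open>labelled_forest\<close> relative to \<open>K\<close>, with open
  \<open>D x\<close>, so that forests on parts of the space can be glued and extended by a
  root.\<close>

definition forest_on :: "'p set \<Rightarrow> ('p \<Rightarrow> 'p set) \<Rightarrow> bool" where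
  "forest_on K D \<longleftrightarrow>
     (\<forall>x\<in>K. x \<in> D x \<and> D x \<subseteq> K \<and> openin X (D x)) \<and>
     (\<forall>x\<in>K. \<forall>y\<in>D x. \<forall>z\<in>D y. y \<noteq> x \<longrightarrow> z \<in> D x \<and> z \<noteq> x \<and> lab x z = lab x y) \<and>
     (\<forall>x\<in>K. \<forall>z\<in>K. D x \<inter> D z \<noteq> {} \<longrightarrow> x \<in> D z \<or> z \<in> D x) \<and>
     (\<forall>y\<in>K. finite {x \<in> K. y \<in> D x}) \<and>
     wf {(y, x). x \<in> K \<and> y \<in> D x \<and> y \<noteq> x}"

lemma forest_onD:
  assumes F: "forest_on K D"
  shows forest_on_self: "x \<in> K \<Longrightarrow> x \<in> D x \<and> D x \<subseteq> K \<and> openin X (D x)"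
    and forest_on_nest: "\<lbrakk>x \<in> K; y \<in> D x; z \<in> D y; y \<noteq> x\<rbrakk> \<Longrightarrow> z \<in> D x \<and> z \<noteq> x \<and> lab x z = lab x y"
    and forest_on_cross: "\<lbrakk>x \<in> K; z \<in> K; y \<in> D x; y \<in> D z\<rbrakk> \<Longrightarrow> x \<in> D z \<or> z \<in> D x"
    and forest_on_finite: "y \<in> K \<Longrightarrow> finite {x \<in> K. y \<in> D x}"
    and forest_on_wf: "wf {(y, x). x \<in> K \<and> y \<in> D x \<and> y \<noteq> x}"
proof -
  note C = F[unfolded forest_on_def]
  show "x \<in> K \<Longrightarrow> x \<in> D x \<and> D x \<subseteq> K \<and> openin X (D x)" using conjunct1[OF C] by (rule bspec)
  show "z \<in> D x \<and> z \<noteq> x \<and> lab x z = lab x y" if "x \<in> K" "y \<in> D x" "z \<in> D y" "y \<noteq> x"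
    using bspec[OF bspec[OF bspec[OF conjunct1[OF conjunct2[OF C]] that(1)] that(2)] that(3)] that(4)
    by (rule mp)
  show "\<lbrakk>x \<in> K; z \<in> K; y \<in> D x; y \<in> D z\<rbrakk> \<Longrightarrow> x \<in> D z \<or> z \<in> D x"
    using conjunct1[OF conjunct2[OF conjunct2[OF C]]] by blast
  show "y \<in> K \<Longrightarrow> finite {x \<in> K. y \<in> D x}"
    using conjunct1[OF conjunct2[OF conjunct2[OF conjunct2[OF C]]]] by (rule bspec)
  show "wf {(y, x). x \<in> K \<and> y \<in> D x \<and> y \<noteq> x}"
    using C by (elim conjE)
qed

text \<open>Each \<open>D i x\<close> stays in its own piece, so every axiom involves a single
  piece; the order relations of different pieces have disjoint fields, whence their union is
  well-founded.\<close>

lemma forest_on_glue: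
  assumes F: "\<And>i. i \<in> p ` K \<Longrightarrow> forest_on {y \<in> K. p y = i} (D i)"
  shows "forest_on K (\<lambda>x. D (p x) x)"
proof -
  have K: "x \<in> D (p x) x \<and> D (p x) x \<subseteq> {y \<in> K. p y = p x} \<and> openin X (D (p x) x)" if "x \<in> K" for x
    using forest_on_self[OF F[OF imageI[OF that]], of x] that by simp
  then have pD: "y \<in> K \<and> p y = p x" if "x \<in> K" "y \<in> D (p x) x" for x y
    using that by blast
  show ?thesis
    unfolding forest_on_def
  proof (intro conjI ballI impI)
    fix x assume x: "x \<in> K"
    show "x \<in> D (p x) x" "D (p x) x \<subseteq> K" "openin X (D (p x) x)" using K[OF x] by auto
    {
      fix y z assume y: "y \<in> D (p x) x" "z \<in> D (p y) y" "y \<noteq> x"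
      have "p y = p x" using pD[OF x y(1)] by (rule conjunct2)
      then have zy: "z \<in> D (p x) y" using y(2) by simp
      have "x \<in> {y \<in> K. p y = p x}" using x by simp
      then have "z \<in> D (p x) x \<and> z \<noteq> x \<and> lab x z = lab x y"
        by (rule forest_on_nest[OF F[OF imageI[OF x]] _ y(1) zy y(3)])
      then show "z \<in> D (p x) x" "z \<noteq> x" "lab x z = lab x y" by auto
    }
    fix z assume z: "z \<in> K" "D (p x) x \<inter> D (p z) z \<noteq> {}"
    then obtain y where y: "y \<in> D (p x) x" "y \<in> D (p z) z" by blast
    have "p z = p x" using pD[OF x y(1)] pD[OF z(1) y(2)] by simp
    then show "x \<in> D (p z) z \<or> z \<in> D (p x) x"
      using forest_on_cross[OF F[OF imageI[OF x]], of x z y] x z(1) y by simp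
  next
    fix y assume y: "y \<in> K"
    have "{x \<in> K. y \<in> D (p x) x} = {x \<in> {x \<in> K. p x = p y}. y \<in> D (p y) x}"
    proof (intro Collect_cong iffI)
      fix x assume x: "x \<in> K \<and> y \<in> D (p x) x"
      have "p y = p x" by (rule conjunct2[OF pD]) (use x in blast)+
      then show "x \<in> {x \<in> K. p x = p y} \<and> y \<in> D (p y) x" using x by simp
    qed simp
    then show "finite {x \<in> K. y \<in> D (p x) x}"
      using forest_on_finite[OF F[OF imageI[OF y]], of y] y by simp
  next
    let ?r = "\<lambda>i. {(y, x). x \<in> {x \<in> K. p x = i} \<and> y \<in> D i x \<and> y \<noteq> x}"
    have "wf (\<Union>i\<in>p ` K. ?r i)"
    proof (rule wf_UN)
      show "wf (?r i)" if "i \<in> p ` K" for i by (rule forest_on_wf[OF F[OF that]])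
      show "Domain (?r i) \<inter> Range (?r j) = {}" if "i \<in> p ` K" "j \<in> p ` K" "?r i \<noteq> ?r j" for i j
      proof -
        have "Domain (?r i) \<subseteq> {x \<in> K. p x = i}"
          using forest_on_self[OF F[OF that(1)]] by blast
        moreover have "Range (?r j) \<subseteq> {x \<in> K. p x = j}" by blast
        moreover have "i \<noteq> j" using that(3) by metis
        then have "{x \<in> K. p x = i} \<inter> {x \<in> K. p x = j} = {}" by auto
        ultimately show ?thesis by (meson disjoint_iff subsetD)
      qed
    qed
    then show "wf {(y, x). x \<in> K \<and> y \<in> D (p x) x \<and> y \<noteq> x}" by (rule wf_subset) blast
  qed
qed

text \<open>The point \<open>x\<close> becomes a root over the given forest. The hypothesis on
  \<open>lab x\<close> is \<open>nest\<close> at the new root; every other point gains just one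
  ancestor.\<close>

lemma forest_on_cone:
  assumes F: "forest_on (C - {x}) D" and C: "openin X C" "x \<in> C"
    and lab: "\<And>y z. y \<in> C - {x} \<Longrightarrow> z \<in> D y \<Longrightarrow> lab x z = lab x y"
  shows "forest_on C (D(x := C))"
proof -
  let ?D = "D(x := C)"
  have sub: "y \<in> D y \<and> D y \<subseteq> C - {x} \<and> openin X (D y)" if "y \<in> C - {x}" for y
    using forest_on_self[OF F that] .
  show ?thesis
    unfolding forest_on_def
  proof (intro conjI ballI impI)
    fix w assume w: "w \<in> C"
    show "w \<in> ?D w" "?D w \<subseteq> C" "openin X (?D w)" using sub[of w] w C by auto
    {
      fix y z assume y: "y \<in> ?D w" "z \<in> ?D y" "y \<noteq> w"
      have yC: "y \<in> C - {x}" using sub[of w] w y by (cases "w = x") auto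
      then have z: "z \<in> D y" "z \<in> C - {x}" using sub[of y] y by auto
      have "z \<in> ?D w \<and> z \<noteq> w \<and> lab w z = lab w y"
      proof (cases "w = x")
        case True
        then show ?thesis using z lab yC by auto
      next
        case False
        then show ?thesis using forest_on_nest[OF F, of w y z] w y z by simp
      qed
      then show "z \<in> ?D w" "z \<noteq> w" "lab w z = lab w y" by auto
    }
    fix z assume z: "z \<in> C" "?D w \<inter> ?D z \<noteq> {}"
    show "w \<in> ?D z \<or> z \<in> ?D w"
      using forest_on_cross[OF F, of w z] w z by (cases "w = x"; cases "z = x") auto
  next
    fix y assume y: "y \<in> C"
    have "{w \<in> C. y \<in> ?D w} \<subseteq> insert x {w \<in> C - {x}. y \<in> D w}" by auto
    moreover have "finite {w \<in> C - {x}. y \<in> D w}"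
    proof (cases "y = x")
      case True
      then have "{w \<in> C - {x}. y \<in> D w} = {}" using sub by auto
      then show ?thesis by (simp only: finite.emptyI)
    next
      case False
      then show ?thesis using forest_on_finite[OF F, of y] y by simp
    qed
    ultimately show "finite {w \<in> C. y \<in> ?D w}" by (meson finite.insertI finite_subset)
  next
    let ?r = "{(y, w). w \<in> C - {x} \<and> y \<in> D w \<and> y \<noteq> w}"
    let ?s = "(C - {x}) \<times> {x}"
    have "wf (?r \<union> ?s)"
    proof (rule wf_Un)
      show "wf ?r" by (rule forest_on_wf[OF F])
      show "wf ?s" by (rule wfI_pf) (auto simp: Image_def)
      show "Domain ?r \<inter> Range ?s = {}" using sub by auto
    qed
    moreover have "{(y, w). w \<in> C \<and> y \<in> ?D w \<and> y \<noteq> w} \<subseteq> ?r \<union> ?s" by (auto split: if_splits)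
    ultimately show "wf {(y, w). w \<in> C \<and> y \<in> ?D w \<and> y \<noteq> w}" by (rule wf_subset)
  qed
qed

section \<open>Existence of a forest in a scattered space\<close>

text \<open>Existence of forests is a local matter: the cells of a disjoint refinement meet
  \<open>K\<close> in clopen sets inside members of \<open>\<G>\<close>, and the forests on these
  are glued.\<close>

lemma forest_on_refine:
  assumes "ultraparacompact_space X" and K: "openin X K" "closedin X K" "K \<subseteq> \<Union>\<G>"
    and G: "\<And>G. G \<in> \<G> \<Longrightarrow> openin X G"
    and F: "\<And>G K'. G \<in> \<G> \<Longrightarrow> openin X K' \<Longrightarrow> closedin X K' \<Longrightarrow> K' \<subseteq> G \<Longrightarrow> \<exists>D. forest_on K' D"
  shows "\<exists>D. forest_on K D"
proof -
  \<comment> \<open>The open complement of \<open>K\<close> completes \<open>\<G>\<close> to a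
    cover; cells inside it do not meet \<open>K\<close>.\<close>
  let ?U = "insert (topspace X - K) \<G>"
  have "(\<forall>U\<in>?U. openin X U) \<and> topspace X \<subseteq> \<Union>?U" using K G by auto
  from mp[OF spec[OF assms(1)[unfolded ultraparacompact_space_def]] this]
  obtain P where P: "\<And>x. x \<in> topspace X \<Longrightarrow>
      x \<in> P x \<and> openin X (P x) \<and> (\<forall>y\<in>P x. P y = P x) \<and> (\<exists>U\<in>?U. P x \<subseteq> U)"
    by metis
  have KX: "K \<subseteq> topspace X" using K openin_subset by blast
  have "\<exists>D. forest_on {y \<in> K. P y = P x} D" if x: "x \<in> K" for x
  proof -
    have xX: "x \<in> topspace X" using x KX by blast
    have eq: "{y \<in> K. P y = P x} = K \<inter> P x"
      using P[OF xX] P KX by blast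
    obtain U where U: "U \<in> ?U" "P x \<subseteq> U" using P[OF xX] by blast
    then have "U \<in> \<G>" using x P[OF xX] by blast
    moreover have "closedin X (P x)" by (rule closedin_partition[OF _ xX]) (use P in blast)
    ultimately show ?thesis
      unfolding eq using F[of U "K \<inter> P x"] K P[OF xX] U by blast
  qed
  then have "\<exists>D. \<forall>i\<in>P ` K. forest_on {y \<in> K. P y = i} (D i)"
    by (intro bchoice) blast
  then show ?thesis using forest_on_glue[of P K] by blast
qed

text \<open>In place of an induction on the Cantor-Bendixson rank, the union of all good open sets
  is considered. A point isolated in its complement would itself have a good neighbourhood, with the
  point as a root.\<close>

lemma forest_on_topspace:
  assumes up: "ultraparacompact_space X" and sc: "scattered_space X"
  shows "\<exists>D. forest_on (topspace X) D"
proof -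
  let ?S = "topspace X"
  \<comment> \<open>Goodness is asked of all clopen subsets of \<open>G\<close>, because refining
    passes to smaller clopen sets.\<close>
  define \<G> where "\<G> = {G. openin X G \<and>
    (\<forall>K. openin X K \<and> closedin X K \<and> K \<subseteq> G \<longrightarrow> (\<exists>D. forest_on K D))}"
  have refine: "\<exists>D. forest_on K D" if "openin X K" "closedin X K" "K \<subseteq> \<Union>\<G>" for K
    by (rule forest_on_refine[OF up that]) (auto simp: \<G>_def)
  have "?S \<subseteq> \<Union>\<G>"
  proof (rule ccontr)
    assume "\<not> ?S \<subseteq> \<Union>\<G>"
    then have "?S - \<Union>\<G> \<subseteq> ?S \<and> ?S - \<Union>\<G> \<noteq> {}" by blast
    from mp[OF spec[OF sc[unfolded scattered_space_def]] this]
    obtain x where x: "x \<in> ?S" "x \<notin> \<Union>\<G>" "openin (subtopology X (?S - \<Union>\<G>)) {x}"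
      by blast
    then obtain U where U: "openin X U" "{x} = U \<inter> (?S - \<Union>\<G>)"
      unfolding openin_subtopology by blast
    then have xU: "x \<in> U" by blast
    obtain H where H: "finite H" "{y \<in> ?S. y = x \<or> lab x y \<notin> H} \<subseteq> U"
      using label_base[OF U(1) xU] by blast
    define C where "C = {y \<in> ?S. y = x \<or> lab x y \<notin> H}"
    have "C = ?S - (\<Union>l\<in>H. {y \<in> ?S. y \<noteq> x \<and> lab x y = l})" by (auto simp: C_def)
    moreover have "closedin X (\<Union>l\<in>H. {y \<in> ?S. y \<noteq> x \<and> lab x y = l})"
      using label_clopen[OF x(1)] H(1) by (intro closedin_Union) auto
    ultimately have Co: "openin X C" by auto
    have CW: "C - {x} \<subseteq> \<Union>\<G>"
    proof
      fix y assume y: "y \<in> C - {x}"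
      then have "y \<in> U" "y \<in> ?S" "y \<noteq> x" using H(2) by (auto simp: C_def)
      then show "y \<in> \<Union>\<G>" using U(2) by blast
    qed
    have "\<exists>D. forest_on K D" if K: "openin X K" "closedin X K" "K \<subseteq> C" for K
    proof (cases "x \<in> K")
      case False
      then show ?thesis using refine[of K] K CW by blast
    next
      case True
      have KX: "K \<subseteq> ?S" using K openin_subset by blast
      \<comment> \<open>The set \<open>K - {x}\<close> need not be closed, but its label classes are
        clopen, so \<open>refine\<close> applies to each. Gluing along the labels makes
        \<open>lab x\<close> constant on every \<open>D y\<close>.\<close>
      have "\<exists>D. forest_on {y \<in> K - {x}. lab x y = l} D" for l
      proof -
        have eq: "{y \<in> K - {x}. lab x y = l} = K \<inter> {y \<in> ?S. y \<noteq> x \<and> lab x y = l}"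
          using KX by blast
        show ?thesis
          unfolding eq
        proof (rule refine)
          show "K \<inter> {y \<in> ?S. y \<noteq> x \<and> lab x y = l} \<subseteq> \<Union>\<G>" using K CW by blast
        qed (use K label_clopen[OF x(1), of l] in blast)+
      qed
      then obtain D where D: "\<And>l. forest_on {y \<in> K - {x}. lab x y = l} (D l)" by metis
      have "forest_on (K - {x}) (\<lambda>y. D (lab x y) y)" using forest_on_glue[of "lab x"] D by blast
      moreover have "lab x z = lab x y" if "y \<in> K - {x}" "z \<in> D (lab x y) y" for y z
        using forest_on_self[OF D[of "lab x y"], of y] that by auto
      ultimately show ?thesis using forest_on_cone[OF _ K(1) True] by blast
    qed
    then have "C \<in> \<G>" using Co by (auto simp: \<G>_def)
    moreover have "x \<in> C" using x by (auto simp: C_def)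
    ultimately show False using x(2) by blast
  qed
  then show ?thesis using refine[of ?S] by auto
qed

text \<open>Removing finitely many label classes from \<open>D x\<close> leaves an open set, as the
  classes are closed, and by \<open>label_base\<close> an arbitrarily small one; this gives
  \<open>open_iff\<close>.\<close>

lemma labelled_forest_exists:
  assumes "ultraparacompact_space X" "scattered_space X"
    and rv: "\<And>x y m n. \<lbrakk>x \<in> topspace X; y \<in> topspace X; rv x m = rv y n\<rbrakk> \<Longrightarrow> x = y \<and> m = n"
    and hv: "\<And>x y k l. \<lbrakk>x \<in> topspace X; y \<in> topspace X; hv x k = hv y l\<rbrakk> \<Longrightarrow> x = y \<and> k = l"
    and rh: "\<And>x y m l. \<lbrakk>x \<in> topspace X; y \<in> topspace X\<rbrakk> \<Longrightarrow> rv x m \<noteq> hv y l"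
  shows "\<exists>D. labelled_forest X D lab rv hv"
proof -
  let ?S = "topspace X"
  obtain D where D: "forest_on ?S D" using forest_on_topspace[OF assms(1,2)] by blast
  have D1: "x \<in> D x \<and> D x \<subseteq> ?S \<and> openin X (D x)" if "x \<in> ?S" for x
    using forest_on_self[OF D that] .
  have nb: "openin X {y \<in> D x. y = x \<or> lab x y \<notin> H}" if x: "x \<in> ?S" and H: "finite H" for x H
  proof -
    have "{y \<in> D x. y = x \<or> lab x y \<notin> H} = D x - (\<Union>l\<in>H. {y \<in> ?S. y \<noteq> x \<and> lab x y = l})"
      using D1[OF x] by blast
    moreover have "closedin X (\<Union>l\<in>H. {y \<in> ?S. y \<noteq> x \<and> lab x y = l})"
      using label_clopen[OF x] H by (intro closedin_Union) auto
    ultimately show ?thesis using D1[OF x] by auto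
  qed
  have "openin X U \<longleftrightarrow> U \<subseteq> ?S \<and>
      (\<forall>x\<in>U. \<exists>H. finite H \<and> {y \<in> D x. y = x \<or> lab x y \<notin> H} \<subseteq> U)" for U
  proof
    assume U: "openin X U"
    have "\<exists>H. finite H \<and> {y \<in> D x. y = x \<or> lab x y \<notin> H} \<subseteq> U" if x: "x \<in> U" for x
    proof -
      obtain H where H: "finite H" "{y \<in> ?S. y = x \<or> lab x y \<notin> H} \<subseteq> U"
        using label_base[OF U x] by blast
      have "D x \<subseteq> ?S" using D1 U x openin_subset by blast
      then have "{y \<in> D x. y = x \<or> lab x y \<notin> H} \<subseteq> U" using H(2) by blast
      then show ?thesis using H(1) by blast
    qed
    then show "U \<subseteq> ?S \<and> (\<forall>x\<in>U. \<exists>H. finite H \<and> {y \<in> D x. y = x \<or> lab x y \<notin> H} \<subseteq> U)"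
      using U openin_subset by blast
  next
    assume U: "U \<subseteq> ?S \<and> (\<forall>x\<in>U. \<exists>H. finite H \<and> {y \<in> D x. y = x \<or> lab x y \<notin> H} \<subseteq> U)"
    have "\<exists>B. openin X B \<and> x \<in> B \<and> B \<subseteq> U" if x: "x \<in> U" for x
    proof -
      obtain H where H: "finite H" "{y \<in> D x. y = x \<or> lab x y \<notin> H} \<subseteq> U" using U x by blast
      have xS: "x \<in> ?S" using x U by blast
      show ?thesis
        using nb[OF xS H(1)] H(2) D1[OF xS]
        by (intro exI[of _ "{y \<in> D x. y = x \<or> lab x y \<notin> H}"]) simp
    qed
    then show "openin X U" using openin_subopen[of X U] by simp
  qed
  then have "labelled_forest X D lab rv hv"
  proof (unfold_locales, goal_cases)
    case (3 x y z)
    then show ?case using forest_on_nest[OF D, of x y z] by simp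
  next
    case (4 x z y)
    then show ?case using forest_on_cross[OF D, of x z y] by simp
  next
    case (5 y)
    then show ?case using forest_on_finite[OF D, of y] by simp
  next
    case 6
    then show ?case using forest_on_wf[OF D] by simp
  qed (use D1 rv hv rh in auto)
  then show ?thesis by blast
qed

end

section \<open>Ray spaces of special trees\<close>

locale normed_tree =
  fixes T :: "'a set" and r :: "'a rel" and nm :: "'a \<Rightarrow> nat" and X :: "'a set set"
  assumes tree: "order_tree T r"
    and nm_inj: "\<lbrakk>(s, t) \<in> r; nm s = nm t\<rbrakk> \<Longrightarrow> s = t"
    and X_rays: "X \<subseteq> tree_rays T r"
begin

section \<open>Order of the tree and finiteness along rays\<close>

abbreviation le (infix "\<preceq>" 50) where "s \<preceq> t \<equiv> (s, t) \<in> r"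

lemma le_T: "s \<preceq> t \<Longrightarrow> s \<in> T \<and> t \<in> T"
  using tree unfolding order_tree_def partial_order_on_def preorder_on_def by blast

lemma le_trans: "s \<preceq> t \<Longrightarrow> t \<preceq> u \<Longrightarrow> s \<preceq> u"
  using tree unfolding order_tree_def partial_order_on_def preorder_on_def by (blast dest: transD)

lemma le_antisym: "s \<preceq> t \<Longrightarrow> t \<preceq> s \<Longrightarrow> s = t"
  using tree unfolding order_tree_def partial_order_on_def by (blast dest: antisymD)

lemma le_refl: "t \<in> T \<Longrightarrow> t \<preceq> t"
  using tree unfolding order_tree_def partial_order_on_def preorder_on_def refl_on_def by blast

definition lt :: "'a rel" where "lt = {(s, t). s \<preceq> t \<and> s \<noteq> t}"

lemma wf_lt: "wf lt"
proof (rule wfI_min)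
  fix x :: 'a and Q assume xQ: "x \<in> Q"
  show "\<exists>z\<in>Q. \<forall>y. (y, z) \<in> lt \<longrightarrow> y \<notin> Q"
  proof (cases "x \<in> T")
    case False
    \<comment> \<open>Nothing lies below an element outside \<open>T\<close>, so \<open>x\<close>
      itself is minimal.\<close>
    then show ?thesis using xQ le_T unfolding lt_def by blast
  next
    case True
    have wf: "wf (Restr r (under r x) - Id)"
      using tree True unfolding order_tree_def well_order_on_def by blast
    have "x \<in> Q \<inter> under r x" using xQ le_refl[OF True] by (simp add: under_def)
    from wfE_min[OF wf this] obtain z where z: "z \<in> Q \<inter> under r x"
      and min: "\<And>y. (y, z) \<in> Restr r (under r x) - Id \<Longrightarrow> y \<notin> Q \<inter> under r x" by blast
    have "y \<notin> Q" if y: "(y, z) \<in> lt" for y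
    proof -
      have "y \<in> under r x" using y z le_trans unfolding under_def lt_def by blast
      then show ?thesis using min[of y] y z unfolding lt_def by blast
    qed
    then show ?thesis using z by blast
  qed
qed

lemma
  assumes "x \<in> X"
  shows ray_T: "t \<in> x \<Longrightarrow> t \<in> T"
    and ray_ne: "x \<noteq> {}"
    and ray_chain: "s \<in> x \<Longrightarrow> t \<in> x \<Longrightarrow> s \<preceq> t \<or> t \<preceq> s"
    and ray_down: "t \<in> x \<Longrightarrow> s \<preceq> t \<Longrightarrow> s \<in> x"
    and ray_nomax: "t \<in> x \<Longrightarrow> \<exists>s\<in>x. t \<preceq> s \<and> s \<noteq> t"
proof -
  have "x \<in> tree_rays T r" using assms X_rays by blast
  note x = this[unfolded tree_rays_def Chains_def, simplified]
  show "t \<in> x \<Longrightarrow> t \<in> T" using x by blast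
  show "x \<noteq> {}" using x by blast
  show "s \<in> x \<Longrightarrow> t \<in> x \<Longrightarrow> s \<preceq> t \<or> t \<preceq> s" using x by blast
  show "t \<in> x \<Longrightarrow> s \<preceq> t \<Longrightarrow> s \<in> x" using x le_T by blast
  show "t \<in> x \<Longrightarrow> \<exists>s\<in>x. t \<preceq> s \<and> s \<noteq> t" using x by blast
qed

lemma finite_max:
  assumes x: "x \<in> X" and B: "finite B" "B \<noteq> {}" "B \<subseteq> x"
  shows "\<exists>t\<in>B. \<forall>b\<in>B. b \<preceq> t"
  using B
proof (induction B rule: finite_ne_induct)
  case (singleton b)
  then show ?case using le_refl ray_T[OF x] by blast
next
  case (insert b B)
  then obtain t where t: "t \<in> B" "\<forall>b\<in>B. b \<preceq> t" by blast
  have bx: "b \<in> x" "t \<in> x" using insert t(1) by blast+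
  from ray_chain[OF x bx(2,1)] show ?case
  proof
    assume "t \<preceq> b"
    then show ?thesis using t le_trans le_refl[OF ray_T[OF x bx(1)]] by blast
  next
    assume "b \<preceq> t"
    then show ?thesis using t by blast
  qed
qed

text \<open>A finite ray would have a greatest element. Infinity later tells rays from singletons in
  the coding of the hubs.\<close>

lemma infinite_ray:
  assumes x: "x \<in> X"
  shows "infinite x"
proof
  assume "finite x"
  from finite_max[OF x this ray_ne[OF x] order_refl] obtain t where t: "t \<in> x" "\<forall>b\<in>x. b \<preceq> t" by blast
  with ray_nomax[OF x t(1)] le_antisym show False by blast
qed

lemma finite_nm:
  assumes x: "x \<in> X"
  shows "finite {v \<in> x. nm v \<le> n}"
proof -
  have "inj_on nm {v \<in> x. nm v \<le> n}"
    by (rule inj_onI) (metis (no_types, lifting) mem_Collect_eq nm_inj ray_chain[OF x])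
  moreover have "finite (nm ` {v \<in> x. nm v \<le> n})"
    by (rule finite_subset[of _ "{..n}"]) auto
  ultimately show ?thesis using finite_imageD by blast
qed

section \<open>The topology of the ray space\<close>

abbreviation "\<X> \<equiv> subtopology (ray_space T r) X"

lemma subspace_eq: "\<X> = subtopology (powerset_topology T) X"
  unfolding ray_space_def subtopology_subtopology using X_rays by (simp add: inf.absorb2)

lemma X_T: "x \<in> X \<Longrightarrow> x \<subseteq> T"
  using ray_T by blast

lemma openin_X:
  "openin \<X> U \<longleftrightarrow>
     U \<subseteq> X \<and> (\<forall>x\<in>U. \<exists>A. finite A \<and> A \<subseteq> T \<and> {y \<in> X. y \<inter> A = x \<inter> A} \<subseteq> U)" (is "_ \<longleftrightarrow> ?rhs")
proof -
  let ?f = "\<lambda>A. restrict (\<lambda>t. t \<in> A) T"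
  let ?P = "product_topology (\<lambda>_. discrete_topology (UNIV :: bool set)) T"
  have op: "openin \<X> U \<longleftrightarrow> (\<exists>W. openin ?P W \<and> U = {y \<in> X. ?f y \<in> W})" for U
  proof -
    have eq: "U = (?f -` W \<inter> Pow T) \<inter> X \<longleftrightarrow> U = {y \<in> X. ?f y \<in> W}" for W
    proof -
      have "(?f -` W \<inter> Pow T) \<inter> X = {y \<in> X. ?f y \<in> W}" using X_T by blast
      then show ?thesis by simp
    qed
    show ?thesis
      unfolding subspace_eq openin_subtopology powerset_topology_def openin_pullback_topology eq[symmetric]
      by blast
  qed
  show ?thesis
  proof
    assume "openin \<X> U"
    then obtain W where W: "openin ?P W" "U = {y \<in> X. ?f y \<in> W}" unfolding op by blast
    have "\<exists>A. finite A \<and> A \<subseteq> T \<and> {y \<in> X. y \<inter> A = x \<inter> A} \<subseteq> U" if x: "x \<in> U" for x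
    proof -
      have "?f x \<in> W" using x W(2) by blast
      with W(1) obtain Q where Q: "finite {i \<in> T. Q i \<noteq> (UNIV :: bool set)}"
        "?f x \<in> Pi\<^sub>E T Q" "Pi\<^sub>E T Q \<subseteq> W"
        unfolding openin_product_topology_alt topspace_discrete_topology by meson
      let ?A = "{i \<in> T. Q i \<noteq> UNIV}"
      have "y \<in> U" if y: "y \<in> X" "y \<inter> ?A = x \<inter> ?A" for y
      proof -
        have "?f y \<in> Pi\<^sub>E T Q"
        proof (rule PiE_I)
          fix t assume t: "t \<in> T"
          show "?f y t \<in> Q t"
          proof (cases "t \<in> ?A")
            case True
            then have "(t \<in> y) = (t \<in> x)" using y(2) by blast
            moreover have "?f x t \<in> Q t" using Q(2) t by (rule PiE_mem)
            ultimately show ?thesis using t by simp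
          next
            case False
            then show ?thesis using t by blast
          qed
        qed simp
        then show ?thesis using Q(3) W(2) y(1) by blast
      qed
      then show ?thesis using Q(1) by (intro exI[of _ ?A]) blast
    qed
    then show ?rhs using W(2) by blast
  next
    assume U: ?rhs
    have base: "openin \<X> {y \<in> X. y \<inter> A = x \<inter> A}" if A: "finite A" "A \<subseteq> T" for A x
    proof -
      let ?Q = "\<lambda>t. if t \<in> A then {t \<in> x} else UNIV"
      have "{i \<in> T. ?Q i \<noteq> topspace (discrete_topology (UNIV :: bool set))} \<subseteq> A" by auto
      then have "finite {i \<in> T. ?Q i \<noteq> topspace (discrete_topology (UNIV :: bool set))}"
        using A(1) finite_subset by blast
      then have "openin ?P (Pi\<^sub>E T ?Q)" unfolding openin_PiE_gen by simp
      moreover have "(?f y \<in> Pi\<^sub>E T ?Q) \<longleftrightarrow> y \<inter> A = x \<inter> A" for y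
        using A(2) by (auto simp: PiE_iff split: if_splits)
      ultimately show ?thesis unfolding op by (intro exI[of _ "Pi\<^sub>E T ?Q"]) simp
    qed
    have "\<exists>B. openin \<X> B \<and> x \<in> B \<and> B \<subseteq> U" if x: "x \<in> U" for x
    proof -
      obtain A where A: "finite A" "A \<subseteq> T" "{y \<in> X. y \<inter> A = x \<inter> A} \<subseteq> U" using U x by meson
      have "x \<in> {y \<in> X. y \<inter> A = x \<inter> A}" using U x by blast
      then show ?thesis using base[OF A(1,2)] A(3) by blast
    qed
    then show "openin \<X> U" using openin_subopen[of \<X> U] by simp
  qed
qed

lemma topspace_X: "topspace \<X> = X"
proof
  have "openin \<X> X" unfolding openin_X by blast
  then show "X \<subseteq> topspace \<X>" by (rule openin_subset)
qed simp

lemma openin_determined: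
  assumes "finite A" "A \<subseteq> T" "K \<subseteq> X"
    and "\<And>y y'. y \<in> K \<Longrightarrow> y' \<in> X \<Longrightarrow> y' \<inter> A = y \<inter> A \<Longrightarrow> y' \<in> K"
  shows "openin \<X> K"
  unfolding openin_X using assms by (intro conjI ballI exI[of _ A]) auto

lemma clopen_determined:
  assumes "finite A" "A \<subseteq> T" "K \<subseteq> X"
    and "\<And>y y'. y \<in> K \<Longrightarrow> y' \<in> X \<Longrightarrow> y' \<inter> A = y \<inter> A \<Longrightarrow> y' \<in> K"
  shows "openin \<X> K \<and> closedin \<X> K"
proof -
  have "openin \<X> (X - K)"
  proof (rule openin_determined[OF assms(1,2)])
    fix y y' assume "y \<in> X - K" "y' \<in> X" "y' \<inter> A = y \<inter> A"
    then show "y' \<in> X - K" using assms(4)[of y' y] by auto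
  qed simp
  moreover have "openin \<X> K" by (rule openin_determined[OF assms])
  ultimately show ?thesis unfolding closedin_def topspace_X using assms(3) by blast
qed

section \<open>Labels relative to a given ray\<close>

text \<open>For distinct rays the label lies in \<open>x\<close> exactly if \<open>y\<close> misses
  part of \<open>x\<close>, so it reveals the case. At \<open>y = x\<close> there is nothing to
  choose and the value is arbitrary; label classes leave \<open>x\<close> out.\<close>

definition lab :: "'a set \<Rightarrow> 'a set \<Rightarrow> 'a" where
  "lab x y = (if x \<subseteq> y then SOME s. s \<in> y - x \<and> (\<forall>u\<in>y - x. s \<preceq> u)
              else ARG_MIN nm u. u \<in> x - y)"

lemma lab_not_subset:
  assumes "\<not> x \<subseteq> y"
  shows "lab x y \<in> x - y" and "v \<in> x - y \<Longrightarrow> nm (lab x y) \<le> nm v"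
proof -
  obtain k where k: "k \<in> x - y" using assms by blast
  have eq: "lab x y = (ARG_MIN nm u. u \<in> x - y)" using assms by (simp add: lab_def)
  have *: "lab x y \<in> x - y \<and> (\<forall>v. v \<in> x - y \<longrightarrow> nm (lab x y) \<le> nm v)"
    unfolding eq using arg_min_nat_lemma[of "\<lambda>u. u \<in> x - y" k nm, OF k] .
  show "lab x y \<in> x - y" using * by (rule conjunct1)
  show "v \<in> x - y \<Longrightarrow> nm (lab x y) \<le> nm v" using * by blast
qed

lemma lab_subset:
  assumes y: "y \<in> X" and xy: "x \<subseteq> y" "x \<noteq> y"
  shows "lab x y \<in> y - x" and "u \<in> y - x \<Longrightarrow> lab x y \<preceq> u"
proof -
  obtain k where "k \<in> y - x" using xy by blast
  from wfE_min[OF wf_lt this] obtain s where s: "s \<in> y - x" and min: "\<And>v. (v, s) \<in> lt \<Longrightarrow> v \<notin> y - x"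
    by blast
  have "s \<preceq> u" if u: "u \<in> y - x" for u
    using ray_chain[OF y, of s u] min[of u] s u le_refl[OF ray_T[OF y]] unfolding lt_def by blast
  then have "\<exists>s. s \<in> y - x \<and> (\<forall>u\<in>y - x. s \<preceq> u)" using s by blast
  from someI_ex[OF this] have *: "lab x y \<in> y - x \<and> (\<forall>u\<in>y - x. lab x y \<preceq> u)"
    using xy(1) by (simp add: lab_def)
  show "lab x y \<in> y - x" using * by (rule conjunct1)
  show "u \<in> y - x \<Longrightarrow> lab x y \<preceq> u" using * by blast
qed

text \<open>The least element of \<open>y - x\<close> lies above all of \<open>x\<close>, so a ray
  \<open>z\<close> through it contains \<open>x\<close>. The least element of \<open>z - x\<close>
  is below it, hence in \<open>y\<close>, and the two least elements are below each other.\<close>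

lemma lab_above:
  assumes x: "x \<in> X" and y: "y \<in> X" "x \<subseteq> y" "x \<noteq> y" and z: "z \<in> X" "lab x y \<in> z"
  shows "z \<noteq> x \<and> lab x z = lab x y"
proof -
  note l = lab_subset[OF y]
  have zx: "x \<noteq> z" using z(2) l(1) by blast
  have "x \<subseteq> z"
  proof
    fix v assume v: "v \<in> x"
    have "v \<preceq> lab x y"
      using ray_chain[OF y(1), of v "lab x y"] ray_down[OF x v, of "lab x y"] l(1) v y(2) by blast
    then show "v \<in> z" using ray_down[OF z] by blast
  qed
  note m = lab_subset[OF z(1) this zx]
  have 1: "lab x z \<preceq> lab x y" using m(2) z(2) l(1) by blast
  have "lab x z \<in> y - x" using ray_down[OF y(1) _ 1] l(1) m(1) by blast
  then have "lab x y \<preceq> lab x z" by (rule l(2))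
  then show ?thesis using 1 le_antisym zx by blast
qed

text \<open>If \<open>l\<close> is in \<open>x\<close>, the class consists of the rays that miss
  \<open>l\<close> and contain the finitely many elements of \<open>x\<close> of smaller norm.
  Otherwise a non-empty class is the set of all rays through \<open>l\<close>. Finitely many
  coordinates decide either condition.\<close>

lemma lab_clopen:
  assumes x: "x \<in> X"
  shows "openin \<X> {y \<in> X. y \<noteq> x \<and> lab x y = l} \<and> closedin \<X> {y \<in> X. y \<noteq> x \<and> lab x y = l}"
proof (cases "l \<in> x")
  case True
  let ?A = "{v \<in> x. nm v \<le> nm l}"
  have iff: "y \<noteq> x \<and> lab x y = l \<longleftrightarrow> l \<notin> y \<and> (\<forall>v\<in>?A. v \<noteq> l \<longrightarrow> v \<in> y)" if y: "y \<in> X" for y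
  proof
    assume a: "y \<noteq> x \<and> lab x y = l"
    then have ns: "\<not> x \<subseteq> y" using lab_subset(1)[OF y, of x] True by blast
    have "v \<in> y" if v: "v \<in> ?A" "v \<noteq> l" for v
    proof (rule ccontr)
      assume "v \<notin> y"
      then have "nm l \<le> nm v" using lab_not_subset(2)[OF ns, of v] v a by blast
      then have "nm l = nm v" using v by simp
      then show False using nm_inj[of l v] nm_inj[of v l] ray_chain[OF x True, of v] v by auto
    qed
    then show "l \<notin> y \<and> (\<forall>v\<in>?A. v \<noteq> l \<longrightarrow> v \<in> y)" using lab_not_subset(1)[OF ns] a by blast
  next
    assume a: "l \<notin> y \<and> (\<forall>v\<in>?A. v \<noteq> l \<longrightarrow> v \<in> y)"
    then have ns: "\<not> x \<subseteq> y" using True by blast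
    have "nm (lab x y) \<le> nm l" using lab_not_subset(2)[OF ns] a True by blast
    then have "lab x y = l" using lab_not_subset(1)[OF ns] a by blast
    then show "y \<noteq> x \<and> lab x y = l" using ns by blast
  qed
  show ?thesis
  proof (rule clopen_determined[of ?A])
    show "finite ?A" by (rule finite_nm[OF x])
    show "?A \<subseteq> T" using ray_T[OF x] by blast
    fix y y' assume y: "y \<in> {y \<in> X. y \<noteq> x \<and> lab x y = l}" "y' \<in> X" "y' \<inter> ?A = y \<inter> ?A"
    have "y \<in> X" "y \<noteq> x \<and> lab x y = l" using y(1) by blast+
    then have *: "l \<notin> y \<and> (\<forall>v\<in>?A. v \<noteq> l \<longrightarrow> v \<in> y)" using iff by blast
    have "l \<in> ?A" using True by simp
    then have "l \<notin> y' \<and> (\<forall>v\<in>?A. v \<noteq> l \<longrightarrow> v \<in> y')" using * y(3) by blast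
    then have "y' \<noteq> x \<and> lab x y' = l" using iff[OF y(2)] by blast
    then show "y' \<in> {y \<in> X. y \<noteq> x \<and> lab x y = l}" using y(2) by blast
  qed blast
next
  case False
  let ?K = "{y \<in> X. y \<noteq> x \<and> lab x y = l}"
  show ?thesis
  proof (cases "?K = {}")
    case True
    then show ?thesis by (simp only: openin_empty closedin_empty)
  next
    case ne: False
    have sub: "x \<subseteq> y \<and> l \<in> y" if "y \<in> ?K" for y
    proof -
      have "x \<subseteq> y" using lab_not_subset(1)[of x y] that False by blast
      then show ?thesis using lab_subset(1)[of y x] that by blast
    qed
    obtain y0 where y0: "y0 \<in> X" "y0 \<noteq> x" "lab x y0 = l" using ne by blast
    have K: "?K = {y \<in> X. l \<in> y}"
    proof
      show "?K \<subseteq> {y \<in> X. l \<in> y}" using sub by blast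
      have "x \<subseteq> y0" using sub y0 by blast
      then show "{y \<in> X. l \<in> y} \<subseteq> ?K" using lab_above[OF x y0(1), folded y0(3)] y0(2,3) by auto
    qed
    have "l \<in> T" using sub[of y0] y0 ray_T[OF y0(1), of l] by blast
    then show ?thesis
      unfolding K by (intro clopen_determined[of "{l}"]) auto
  qed
qed

text \<open>A ray missing some \<open>t\<close> of \<open>x\<close> has its label among the finitely
  many elements of \<open>x\<close> of norm at most \<open>nm t\<close>. This settles
  \<open>a\<close> in \<open>x\<close>, and also \<open>a\<close> outside \<open>x\<close> that is
  not above some \<open>t\<close> of \<open>x\<close>, as rays through \<open>a\<close> then miss
  \<open>t\<close>. If \<open>a\<close> is above all of \<open>x\<close>, the rays through
  \<open>a\<close> share one label.\<close>

lemma lab_separates: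
  assumes x: "x \<in> X" and a: "a \<in> T"
  shows "\<exists>H. finite H \<and> (\<forall>y\<in>X. y \<noteq> x \<and> lab x y \<notin> H \<longrightarrow> (a \<in> y \<longleftrightarrow> a \<in> x))"
proof -
  have *: "\<exists>H. finite H \<and> (\<forall>y\<in>X. t \<notin> y \<longrightarrow> lab x y \<in> H)" if t: "t \<in> x" for t
  proof (intro exI conjI ballI impI)
    show "finite {v \<in> x. nm v \<le> nm t}" by (rule finite_nm[OF x])
    fix y assume y: "y \<in> X" "t \<notin> y"
    then have ns: "\<not> x \<subseteq> y" using t by blast
    then show "lab x y \<in> {v \<in> x. nm v \<le> nm t}"
      using lab_not_subset(1)[OF ns] lab_not_subset(2)[OF ns, of t] y t by blast
  qed
  show ?thesis
  proof (cases "a \<in> x")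
    case True
    then show ?thesis using *[OF True] by blast
  next
    case False
    show ?thesis
    proof (cases "\<exists>t\<in>x. \<not> t \<preceq> a")
      case True
      then obtain t where t: "t \<in> x" "\<not> t \<preceq> a" by blast
      have "t \<notin> y" if "y \<in> X" "a \<in> y" for y
        using ray_chain[OF that(1), of t a] that t ray_down[OF x t(1), of a] False by blast
      then show ?thesis using *[OF t(1)] False by blast
    next
      case below: False
      show ?thesis
      proof (cases "\<exists>y0\<in>X. a \<in> y0")
        case True
        then obtain y0 where y0: "y0 \<in> X" "a \<in> y0" by blast
        have s0: "x \<subseteq> y0" "x \<noteq> y0" using ray_down[OF y0] below False y0(2) by blast+
        have "lab x y0 \<preceq> a" using lab_subset(2)[OF y0(1) s0] y0(2) False by blast
        then have "lab x y = lab x y0" if "y \<in> X" "a \<in> y" for y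
          using lab_above[OF x y0(1) s0 that(1)] ray_down[OF that] by blast
        then show ?thesis using False by (intro exI[of _ "{lab x y0}"]) blast
      qed (use False in blast)
    qed
  qed
qed

lemma labelled_space: "labelled_space \<X> lab"
proof
  fix x l assume "x \<in> topspace \<X>"
  then show "openin \<X> {y \<in> topspace \<X>. y \<noteq> x \<and> lab x y = l} \<and>
      closedin \<X> {y \<in> topspace \<X>. y \<noteq> x \<and> lab x y = l}"
    unfolding topspace_X by (rule lab_clopen)
next
  fix U x assume U: "openin \<X> U" "x \<in> U"
  from U obtain A where A: "finite A" "A \<subseteq> T" "{y \<in> X. y \<inter> A = x \<inter> A} \<subseteq> U"
    unfolding openin_X by meson
  have x: "x \<in> X" using U unfolding openin_X by blast
  have "\<forall>a\<in>A. \<exists>H. finite H \<and> (\<forall>y\<in>X. y \<noteq> x \<and> lab x y \<notin> H \<longrightarrow> (a \<in> y \<longleftrightarrow> a \<in> x))"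
    using lab_separates[OF x] A(2) by blast
  from bchoice[OF this] obtain H where
    H: "\<And>a. a \<in> A \<Longrightarrow> finite (H a) \<and> (\<forall>y\<in>X. y \<noteq> x \<and> lab x y \<notin> H a \<longrightarrow> (a \<in> y \<longleftrightarrow> a \<in> x))"
    by blast
  have "y \<in> U" if y: "y \<in> X" "y = x \<or> lab x y \<notin> (\<Union>a\<in>A. H a)" for y
  proof (cases "y = x")
    case False
    then have "\<forall>a\<in>A. a \<in> y \<longleftrightarrow> a \<in> x" using H y by blast
    then have "y \<inter> A = x \<inter> A" by blast
    then show ?thesis using A(3) y(1) by blast
  qed (use U in blast)
  then show "\<exists>H. finite H \<and> {y \<in> topspace \<X>. y = x \<or> lab x y \<notin> H} \<subseteq> U"
    unfolding topspace_X using A(1) H by (intro exI[of _ "\<Union>a\<in>A. H a"]) blast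
qed

section \<open>Ultraparacompactness of the ray space\<close>

text \<open>Rays are downward closed, so finitely many positive conditions reduce to the greatest of
  them; the negative ones form \<open>F\<close>.\<close>

lemma cone_nbhd:
  assumes x: "x \<in> X" "openin \<X> U" "x \<in> U"
  shows "\<exists>t F. t \<in> x \<and> finite F \<and> F \<subseteq> T \<and> F \<inter> x = {} \<and> {y \<in> X. t \<in> y \<and> y \<inter> F = {}} \<subseteq> U"
proof -
  obtain A where A: "finite A" "A \<subseteq> T" "{y \<in> X. y \<inter> A = x \<inter> A} \<subseteq> U"
    using x(2,3) unfolding openin_X by meson
  obtain k where k: "k \<in> x" using ray_ne[OF x(1)] by blast
  \<comment> \<open>The element \<open>k\<close> is a default in case \<open>x\<close> contains no
    element of \<open>A\<close>.\<close>
  obtain t where t: "t \<in> x" "\<forall>b\<in>x \<inter> A. b \<preceq> t"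
    using finite_max[OF x(1), of "insert k (x \<inter> A)"] A(1) k by blast
  have "y \<in> U" if y: "y \<in> X" "t \<in> y" "y \<inter> (A - x) = {}" for y
  proof -
    have "x \<inter> A \<subseteq> y" using t ray_down[OF y(1,2)] by blast
    then have "y \<inter> A = x \<inter> A" using y(3) by blast
    then show ?thesis using A(3) y(1) by blast
  qed
  then show ?thesis using t(1) A(1,2) by (intro exI[of _ t] exI[of _ "A - x"]) blast
qed

end

text \<open>Ultraparacompactness. Each point \<open>x\<close> has a basic neighbourhood inside a member of the cover: the
  rays through \<open>base x\<close> that avoid the finite set \<open>excl x\<close>. Climbing up the tree, a cell starts at the
  first node that lies beyond all earlier cells and is a candidate for some point, and it is given to
  the candidate for which \<open>bnd\<close> is least. If a ray \<open>y\<close> left infinitely many cells beyond \<open>base y\<close>, it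
  would do so through infinitely many nodes of norm at most \<open>bnd y\<close>.\<close>

locale cone_cover = normed_tree T r nm X
  for T :: "'a set" and r :: "'a rel" and nm :: "'a \<Rightarrow> nat" and X :: "'a set set" +
  fixes \<U> :: "'a set set set" and base :: "'a set \<Rightarrow> 'a" and excl :: "'a set \<Rightarrow> 'a set"
    and bnd :: "'a set \<Rightarrow> nat"
  assumes base: "x \<in> X \<Longrightarrow> base x \<in> x"
    and excl: "x \<in> X \<Longrightarrow> finite (excl x) \<and> excl x \<subseteq> T \<and> excl x \<inter> x = {}"
    and cone: "x \<in> X \<Longrightarrow> \<exists>U\<in>\<U>. {y \<in> X. base x \<in> y \<and> y \<inter> excl x = {}} \<subseteq> U"
    and bnd: "x \<in> X \<Longrightarrow> f \<in> excl x \<Longrightarrow> nm f \<le> bnd x"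
begin

text \<open>For a candidate \<open>x\<close>, rays through \<open>u\<close> contain
  \<open>base x\<close>, so those that avoid \<open>excl x\<close> lie in the chosen neighbourhood
  of \<open>x\<close>.\<close>

definition cand :: "'a \<Rightarrow> 'a set \<Rightarrow> bool" where
  "cand u x \<longleftrightarrow> x \<in> X \<and> u \<in> x \<and> base x \<preceq> u"

definition owner :: "'a \<Rightarrow> 'a set" where
  "owner u = (ARG_MIN bnd x. cand u x)"

definition cell :: "'a \<Rightarrow> 'a set set" where
  "cell u = {y \<in> X. u \<in> y \<and> y \<inter> excl (owner u) = {}}"

text \<open>The recursion runs along \<open>lt\<close>. An element excluded by the owner of
  \<open>u'\<close> and lying below \<open>u\<close> puts \<open>u\<close> beyond the cell of
  \<open>u'\<close>: every ray through \<open>u\<close> contains it.\<close>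

definition start :: "'a \<Rightarrow> bool" where
  "start = wfrec lt (\<lambda>st u. (\<exists>x. cand u x) \<and>
     (\<forall>u'. (u', u) \<in> lt \<longrightarrow> st u' \<longrightarrow> (\<exists>f\<in>excl (owner u'). f \<preceq> u)))"

lemma start_iff:
  "start u \<longleftrightarrow> (\<exists>x. cand u x) \<and>
     (\<forall>u'. (u', u) \<in> lt \<longrightarrow> start u' \<longrightarrow> (\<exists>f\<in>excl (owner u'). f \<preceq> u))"
  unfolding start_def by (subst wfrec[OF wf_lt]) (simp add: cut_apply cong: conj_cong imp_cong)

lemma start_cand: "start u \<Longrightarrow> \<exists>x. cand u x"
  using start_iff[of u] by (rule iffD1[THEN conjunct1])

lemma start_before:
  assumes "start u" "start u'" "(u', u) \<in> lt"
  shows "\<exists>f\<in>excl (owner u'). f \<preceq> u"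
  using iffD1[OF start_iff assms(1)] assms(2,3) by blast

lemma owner_cand:
  assumes "cand u y"
  shows "cand u (owner u)" and "bnd (owner u) \<le> bnd y"
proof -
  have *: "cand u (owner u) \<and> (\<forall>y. cand u y \<longrightarrow> bnd (owner u) \<le> bnd y)"
    unfolding owner_def using arg_min_nat_lemma[of "cand u" y bnd, OF assms] .
  show "cand u (owner u)" using * by (rule conjunct1)
  show "bnd (owner u) \<le> bnd y" using * assms by blast
qed

lemma start_owner:
  assumes "start u"
  shows "owner u \<in> X" "u \<in> owner u" "base (owner u) \<preceq> u"
  using start_cand[OF assms] owner_cand(1) unfolding cand_def by blast+

lemma not_excl_below:
  assumes "start u" "f \<in> excl (owner u)"
  shows "\<not> f \<preceq> u"
  using ray_down[OF start_owner(1,2)[OF assms(1)], of f] excl[OF start_owner(1)[OF assms(1)]] assms(2)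
  by blast

text \<open>Two starts on one ray are comparable, and the later one lies beyond an element excluded
  from the earlier cell, which the ray then contains.\<close>

lemma cell_disjoint:
  assumes u: "start u" "start u'" and y: "y \<in> cell u" "y \<in> cell u'"
  shows "u = u'"
proof (rule ccontr)
  assume ne: "u \<noteq> u'"
  have *: False if "start v" "start v'" "y \<in> cell v" "y \<in> cell v'" "(v', v) \<in> lt" for v v'
  proof -
    from start_before[OF that(1,2,5)] obtain f where f: "f \<in> excl (owner v')" "f \<preceq> v" by blast
    have v: "y \<in> X" "v \<in> y" using that(3) unfolding cell_def by blast+
    have "f \<in> y" by (rule ray_down[OF v f(2)])
    then show False using f(1) that(4) unfolding cell_def by blast
  qed
  have "y \<in> X" "u \<in> y" "u' \<in> y" using y unfolding cell_def by blast+
  then have "(u, u') \<in> lt \<or> (u', u) \<in> lt" using ray_chain ne unfolding lt_def by blast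
  then show False using *[OF u y] *[OF u(2,1) y(2,1)] by blast
qed

text \<open>The new start is the least excluded element \<open>f\<close> on \<open>y\<close>. A
  start between \<open>u\<close> and \<open>f\<close> would lie beyond a smaller excluded element;
  starts before \<open>u\<close> are handled by \<open>start_before\<close>. The node
  \<open>w\<close> ensures that \<open>f\<close> lies beyond \<open>base y\<close>, which makes
  \<open>y\<close> a candidate.\<close>

lemma next_start:
  assumes y: "y \<in> X" and u: "start u" "u \<in> y" "y \<notin> cell u"
    and w: "w \<in> y" "base y \<preceq> w" "u \<preceq> w" "\<And>f. f \<in> excl (owner u) \<Longrightarrow> \<not> f \<preceq> w"
  shows "\<exists>f\<in>y. f \<in> excl (owner u) \<and> start f \<and> (w, f) \<in> lt"
proof -
  have "y \<inter> excl (owner u) \<noteq> {}" using u y unfolding cell_def by blast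
  then obtain k where "k \<in> y \<inter> excl (owner u)" by blast
  from wfE_min[OF wf_lt this] obtain f where f: "f \<in> y" "f \<in> excl (owner u)"
    and min: "\<And>v. (v, f) \<in> lt \<Longrightarrow> v \<notin> y \<inter> excl (owner u)" by blast
  have "w \<preceq> f" using ray_chain[OF y w(1) f(1)] w(4)[OF f(2)] by blast
  moreover have "w \<noteq> f" using w(4)[OF f(2)] le_refl[OF ray_T[OF y w(1)]] by blast
  ultimately have wf: "(w, f) \<in> lt" by (simp add: lt_def)
  have "\<exists>f'\<in>excl (owner v). f' \<preceq> f" if v: "(v, f) \<in> lt" "start v" for v
  proof -
    have vf: "v \<preceq> f" using v(1) by (simp add: lt_def)
    have vy: "v \<in> y" by (rule ray_down[OF y f(1) vf])
    consider "v = u" | "(v, u) \<in> lt" | "(u, v) \<in> lt"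
      using ray_chain[OF y vy u(2)] unfolding lt_def by blast
    then show ?thesis
    proof cases
      case 1
      then show ?thesis using f(2) le_refl[OF ray_T[OF y f(1)]] by blast
    next
      case 2
      from start_before[OF u(1) v(2) 2] obtain f' where "f' \<in> excl (owner v)" "f' \<preceq> u" by blast
      then show ?thesis using le_trans w(3) \<open>w \<preceq> f\<close> by blast
    next
      case 3
      from start_before[OF v(2) u(1) 3] obtain f' where f': "f' \<in> excl (owner u)" "f' \<preceq> v" by blast
      have "f' \<in> y" by (rule ray_down[OF y vy f'(2)])
      moreover have "(f', f) \<in> lt"
        using le_trans[OF f'(2) vf] f'(2) v(1) le_antisym unfolding lt_def by blast
      ultimately show ?thesis using min f'(1) by blast
    qed
  qed
  moreover have "cand f y" unfolding cand_def using y f(1) le_trans[OF w(2) \<open>w \<preceq> f\<close>] by blast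
  ultimately have "start f" unfolding start_iff[of f] by blast
  then show ?thesis using f wf by blast
qed

lemma cells_cover:
  assumes y: "y \<in> X"
  shows "\<exists>u. start u \<and> y \<in> cell u"
proof (rule ccontr)
  assume no: "\<not> (\<exists>u. start u \<and> y \<in> cell u)"
  let ?b = "base y"
  have b: "?b \<in> y" by (rule base[OF y])
  have bb: "?b \<preceq> ?b" by (rule le_refl[OF ray_T[OF y b]])
  have step: "\<exists>f\<in>y. start f \<and> ?b \<preceq> f \<and> nm f \<le> bnd y \<and> (u, f) \<in> lt"
    if u: "start u" "u \<in> y" "?b \<preceq> u" for u
  proof -
    have "y \<notin> cell u" using no u(1) by blast
    from next_start[OF y u(1,2) this u(2,3) le_refl[OF ray_T[OF y u(2)]] not_excl_below[OF u(1)]]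
    obtain f where f: "f \<in> y" "f \<in> excl (owner u)" "start f" "(u, f) \<in> lt" by blast
    \<comment> \<open>As \<open>y\<close> competes for \<open>u\<close>, the owner has a bound of at
      most \<open>bnd y\<close>, and so has the norm of everything it excludes.\<close>
    have "cand u y" using u y by (simp add: cand_def)
    then have "nm f \<le> bnd y"
      using bnd[OF start_owner(1)[OF u(1)] f(2)] owner_cand(2) by (meson order_trans)
    moreover have "?b \<preceq> f" using le_trans[OF u(3)] f(4) by (simp add: lt_def)
    ultimately show ?thesis using f by blast
  qed
  have "\<exists>u\<in>y. start u \<and> ?b \<preceq> u"
  proof (cases "start ?b")
    case True
    then show ?thesis using b bb by blast
  next
    case False
    \<comment> \<open>If \<open>base y\<close> is no start, some earlier start excludes nothing up
      to \<open>base y\<close>; then \<open>y\<close> leaves its cell later, at a new start.\<close>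
    have "cand ?b y" using y b bb by (simp add: cand_def)
    with False obtain u where u: "(u, ?b) \<in> lt" "start u" "\<And>f. f \<in> excl (owner u) \<Longrightarrow> \<not> f \<preceq> ?b"
      unfolding start_iff[of ?b] by blast
    have ub: "u \<preceq> ?b" using u(1) by (simp add: lt_def)
    have "y \<notin> cell u" using no u(2) by blast
    from next_start[OF y u(2) ray_down[OF y b ub] this b bb ub u(3)]
    show ?thesis unfolding lt_def by blast
  qed
  then obtain u0 where u0: "u0 \<in> y" "start u0" "?b \<preceq> u0" by blast
  let ?S = "{u \<in> y. start u \<and> ?b \<preceq> u \<and> nm u \<le> bnd y}"
  have fin: "finite ?S" by (rule finite_subset[OF _ finite_nm[OF y, of "bnd y"]]) blast
  obtain f0 where f0: "f0 \<in> ?S" using step[OF u0(2,1,3)] by blast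
  have ne: "?S \<noteq> {}" and sub: "?S \<subseteq> y" using f0 by blast+
  obtain m where m: "m \<in> ?S" "\<forall>u\<in>?S. u \<preceq> m" using finite_max[OF y fin ne sub] by blast
  have "start m" "m \<in> y" "?b \<preceq> m" using m(1) by blast+
  from step[OF this] obtain f where f: "f \<in> ?S" "(m, f) \<in> lt" by blast
  have "f \<preceq> m" using m(2) f(1) by blast
  then show False using f(2) le_antisym unfolding lt_def by blast
qed

lemma ultraparacompact_partition:
  "\<exists>P. \<forall>x\<in>topspace \<X>. x \<in> P x \<and> openin \<X> (P x) \<and> (\<forall>y\<in>P x. P y = P x) \<and> (\<exists>U\<in>\<U>. P x \<subseteq> U)"
proof (intro exI ballI)
  define s where "s y = (SOME u. start u \<and> y \<in> cell u)" for y
  have s: "start (s y) \<and> y \<in> cell (s y)" if "y \<in> X" for y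
    unfolding s_def by (rule someI_ex[OF cells_cover[OF that]])
  fix x assume "x \<in> topspace \<X>"
  then have x: "x \<in> X" by (simp add: topspace_X)
  have st: "start (s x)" using s[OF x] by (rule conjunct1)
  have own: "owner (s x) \<in> X" by (rule start_owner(1)[OF st])
  have sT: "s x \<in> T" using ray_T[OF own start_owner(2)[OF st]] .
  have op: "openin \<X> (cell (s x))"
  proof (rule openin_determined)
    show "finite (insert (s x) (excl (owner (s x))))" "insert (s x) (excl (owner (s x))) \<subseteq> T"
      using excl[OF own] sT by blast+
    show "cell (s x) \<subseteq> X" unfolding cell_def by blast
    fix y y' assume y: "y \<in> cell (s x)" "y' \<in> X"
      and eq: "y' \<inter> insert (s x) (excl (owner (s x))) = y \<inter> insert (s x) (excl (owner (s x)))"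
    show "y' \<in> cell (s x)" using y eq unfolding cell_def by blast
  qed
  have same: "cell (s y) = cell (s x)" if "y \<in> cell (s x)" for y
  proof -
    have "y \<in> X" using that unfolding cell_def by blast
    from s[OF this] have "s y = s x" using cell_disjoint[OF _ st _ that] by blast
    then show ?thesis by simp
  qed
  obtain U where U: "U \<in> \<U>" "{y \<in> X. base (owner (s x)) \<in> y \<and> y \<inter> excl (owner (s x)) = {}} \<subseteq> U"
    using cone[OF own] by blast
  have "cell (s x) \<subseteq> U"
  proof
    fix y assume "y \<in> cell (s x)"
    then have y: "y \<in> X" "s x \<in> y" "y \<inter> excl (owner (s x)) = {}" unfolding cell_def by blast+
    have "base (owner (s x)) \<in> y" by (rule ray_down[OF y(1,2) start_owner(3)[OF st]])
    then show "y \<in> U" using U(2) y by blast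
  qed
  then show "x \<in> cell (s x) \<and> openin \<X> (cell (s x)) \<and> (\<forall>y\<in>cell (s x). cell (s y) = cell (s x)) \<and>
      (\<exists>U\<in>\<U>. cell (s x) \<subseteq> U)"
    using s[OF x] op same U(1) by blast
qed

end

lemma (in normed_tree) ultraparacompact: "ultraparacompact_space \<X>"
  unfolding ultraparacompact_space_def
proof (intro allI impI)
  fix \<U> assume U: "(\<forall>U\<in>\<U>. openin \<X> U) \<and> topspace \<X> \<subseteq> \<Union>\<U>"
  have "\<forall>x\<in>X. \<exists>p. fst p \<in> x \<and> finite (snd p) \<and> snd p \<subseteq> T \<and> snd p \<inter> x = {} \<and>
    (\<exists>U\<in>\<U>. {y \<in> X. fst p \<in> y \<and> y \<inter> snd p = {}} \<subseteq> U)"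
  proof
    fix x assume x: "x \<in> X"
    then obtain U where U: "U \<in> \<U>" "openin \<X> U" "x \<in> U" using U unfolding topspace_X by blast
    from cone_nbhd[OF x U(2,3)] obtain t F where
      "t \<in> x" "finite F" "F \<subseteq> T" "F \<inter> x = {}" "{y \<in> X. t \<in> y \<and> y \<inter> F = {}} \<subseteq> U" by blast
    then show "\<exists>p. fst p \<in> x \<and> finite (snd p) \<and> snd p \<subseteq> T \<and> snd p \<inter> x = {} \<and>
      (\<exists>U\<in>\<U>. {y \<in> X. fst p \<in> y \<and> y \<inter> snd p = {}} \<subseteq> U)"
      using U(1) by (intro exI[of _ "(t, F)"]) auto
  qed
  from bchoice[OF this] obtain p where p: "\<forall>x\<in>X. fst (p x) \<in> x \<and> finite (snd (p x)) \<and>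
    snd (p x) \<subseteq> T \<and> snd (p x) \<inter> x = {} \<and>
    (\<exists>U\<in>\<U>. {y \<in> X. fst (p x) \<in> y \<and> y \<inter> snd (p x) = {}} \<subseteq> U)" ..
  \<comment> \<open>If nothing is excluded, \<open>Max\<close> is taken of the empty set and is
    unspecified, but then the bound is required of no element.\<close>
  interpret cone_cover T r nm X \<U> "\<lambda>x. fst (p x)" "\<lambda>x. snd (p x)" "\<lambda>x. Max (nm ` snd (p x))"
  proof
    fix x assume x: "x \<in> X"
    note px = bspec[OF p x]
    show "fst (p x) \<in> x" "finite (snd (p x)) \<and> snd (p x) \<subseteq> T \<and> snd (p x) \<inter> x = {}"
      "\<exists>U\<in>\<U>. {y \<in> X. fst (p x) \<in> y \<and> y \<inter> snd (p x) = {}} \<subseteq> U"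
      using px by blast+
    show "nm f \<le> Max (nm ` snd (p x))" if "f \<in> snd (p x)" for f
      using px that by (intro Max_ge) auto
  qed
  show "\<exists>P. \<forall>x\<in>topspace \<X>. x \<in> P x \<and> openin \<X> (P x) \<and> (\<forall>y\<in>P x. P y = P x) \<and> (\<exists>U\<in>\<U>. P x \<subseteq> U)"
    by (rule ultraparacompact_partition)
qed

section \<open>From a special tree to a graph with the given end space\<close>

theorem theorem5p10:
  fixes T :: "'a set" and r :: "'a rel" and X :: "'a set set"
  assumes "order_tree T r"
    and "special T r"
    and "X \<subseteq> tree_rays T r"
    and "scattered_space (subtopology (ray_space T r) X)"
  shows "end_space TYPE(nat \<times> 'a set set) (subtopology (ray_space T r) X)"
proof -
  obtain A :: "nat \<Rightarrow> 'a set" where A: "\<And>n. antichain_in T r (A n)" "T = (\<Union>n. A n)"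
    using assms(2) unfolding special_def by blast
  \<comment> \<open>Comparable elements of one antichain are equal, so the first index of an
    antichain containing \<open>t\<close> is injective on chains.\<close>
  define nm where "nm t = (LEAST n. t \<in> A n)" for t
  have nm: "t \<in> A (nm t)" if t: "t \<in> T" for t
  proof -
    obtain n where "t \<in> A n" using A(2) t by blast
    then show ?thesis unfolding nm_def by (rule LeastI)
  qed
  have r: "r \<subseteq> T \<times> T"
    using assms(1) unfolding order_tree_def partial_order_on_def preorder_on_def by blast
  interpret normed_tree T r nm X
  proof
    fix s t assume st: "(s, t) \<in> r" "nm s = nm t"
    then have "s \<in> A (nm s)" "t \<in> A (nm s)" using nm[of s] nm[of t] r by auto
    then show "s = t" using A(1)[of "nm s"] st(1) unfolding antichain_in_def by blast
  qed (use assms in blast)+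
  interpret labelled_space \<X> lab by (rule labelled_space)
  \<comment> \<open>\<open>?hv\<close> is injective because rays are infinite.\<close>
  let ?rv = "\<lambda>x n. (Suc n, {x}) :: nat \<times> 'a set set"
  let ?hv = "\<lambda>x l. (0, {x, {l}}) :: nat \<times> 'a set set"
  have "\<exists>D. labelled_forest \<X> D lab ?rv ?hv"
  proof (rule labelled_forest_exists[OF ultraparacompact assms(4)])
    fix x y k l assume xy: "x \<in> topspace \<X>" "y \<in> topspace \<X>" "?hv x k = ?hv y l"
    then have "infinite x" "infinite y" using infinite_ray by (simp_all add: topspace_X)
    then have "x \<noteq> {l}" "y \<noteq> {k}" by auto
    then show "x = y \<and> k = l" using xy(3) by (auto simp: doubleton_eq_iff)
  qed auto
  then obtain D where "labelled_forest \<X> D lab ?rv ?hv" by blast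
  then interpret labelled_forest \<X> D lab ?rv ?hv .
  show ?thesis
    unfolding end_space_def using simple_graph_V_E homeomorphic_end_topology by blast
qed

end
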